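(* Let $\vec p=(1,\infty)$, and let $\vec a,\vec b,\vec c\in\mathbb{R}^2$, $\vec\alpha\in(-1,\infty)^2$. Then the following are equivalent: (1) $S_{\vec a,\vec b,\vec c}$ is bounded from $L^{\vec p}_{\vec\alpha}(T_B\times T_B)$ to $L^\infty(T_B\times T_B)$; (2) $T_{\vec a,\vec b,\vec c}$ is bounded from $L^{\vec p}_{\vec\alpha}(T_B\times T_B)$ to $L^\infty(T_B\times T_B)$; (3) $a_1\ge0$, $a_2>0$, $b_1\ge\alpha_1$, $b_2>-1$, $c_1=a_1+b_1-\alpha_1$, and $c_2=n+1+a_2+b_2$.
   Context: Let $n$ be a positive integer. For $z=(z_1,\dots,z_n)\in\mathbb{C}^n$ write $z=x+iy$ with $x,y\in\mathbb{R}^n$, $z'=(z_1,\dots,z_{n-1})$, $y'=(y_1,\dots,y_{n-1})$. Let $B=\{y\in\mathbb{R}^n: |y'|^2<y_n\}$ and $T_B=\{x+iy: x\in\mathbb{R}^n, y\in B\}$. For $z\in T_B$ put $\rho(z)=y_n-|y'|^2>0$, and for $z,u\in T_B$ put $\rho(z,u)=\frac14\big(\sum_{j=1}^{n-1}(z_j-\overline{u_j})^2-2i(z_n-\overline{u_n})\big)$; this has positive real part, and complex powers $\rho(z,u)^c$ are taken with the principal branch. $dV$ is Lebesgue measure on $\mathbb{C}^n$ and $dV_\alpha(z)=\rho(z)^\alpha dV(z)$. For $\vec p=(p_1,p_2)\in[1,\infty]^2$ and $\vec\alpha=(\alpha_1,\alpha_2)$, $L^{\vec p}_{\vec\alpha}(T_B\times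 T_B)$ is the space of measurable $f$ on $T_B\times T_B$ with finite mixed norm $\|f\|_{\vec p,\vec\alpha}=\big\{\int_{T_B}\big(\int_{T_B}|f(z,w)|^{p_1}dV_{\alpha_1}(z)\big)^{p_2/p_1}dV_{\alpha_2}(w)\big\}^{1/p_2}$, with the inner (resp. outer) integral replaced by an essential supremum in $z$ (resp. $w$) when $p_1=\infty$ (resp. $p_2=\infty$); in particular for $\vec p=(1,\infty)$, $\|f\|=\operatorname{ess\,sup}_{w}\int_{T_B}|f(z,w)|dV_{\alpha_1}(z)$. When $\vec p=(\infty,\infty)$ this is $L^\infty(T_B\times T_B)$. For $\vec a=(a_1,a_2),\vec b=(b_1,b_2),\vec c=(c_1,c_2)\in\mathbb{R}^2$, $T_{\vec a,\vec b,\vec c}f(z,w)=\rho(z)^{a_1}\rho(w)^{a_2}\int_{T_B}\int_{T_B}\frac{\rho(u)^{b_1}\rho(\eta)^{b_2}}{\rho(z,u)^{c_1}\rho(w,\eta)^{c_2}}f(u,\eta)\,dV(u)\,dV(\eta)$ and $S_{\vec a,\vec b,\vec c}f(z,w)=\rho(z)^{a_1}\rho(w)^{a_2}\int_{T_B}\int_{T_B}\frac{\rho(u)^{b_1}\rho(\eta)^{b_2}}{|\rho(z,u)|^{c_1}|\rho(w,\eta)|^{c_2}}f(u,\eta)\,dV(u)\,dV(\eta)$. An operator is bounded from $X$ to $Y$ if for every $f\in X$ the defining integral converges for a.e. $(z,w)$ and $\|Tf\|_Y\le C\|f\|_X$ with $C$ independent of $f$. *)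

theory Defs
  imports "HOL-Analysis.Analysis" "HOL-Probability.Essential_Supremum"
begin

text \<open>Points of C^n are vectors z :: complex^'n, where 'n is an arbitrary finite index
type (n = CARD('n)) and j0 :: 'n is the distinguished index playing the role of the
last coordinate z_n; the remaining indices play the role of z' = (z_1,...,z_{n-1}).\<close>

definition TB :: "'n::finite \<Rightarrow> (complex^'n) set" where
  "TB j0 = {z. (\<Sum>j\<in>UNIV - {j0}. (Im (z$j))^2) < Im (z$j0)}"

definition rho :: "'n::finite \<Rightarrow> complex^'n \<Rightarrow> real" where
  "rho j0 z = Im (z$j0) - (\<Sum>j\<in>UNIV - {j0}. (Im (z$j))^2)"

definition rho2 :: "'n::finite \<Rightarrow> complex^'n \<Rightarrow> complex^'n \<Rightarrow> complex" where
  "rho2 j0 z u = (1/4) * ((\<Sum>j\<in>UNIV - {j0}. (z$j - cnj (u$j))^2) - 2 * \<i> * (z$j0 - cnj (u$j0)))"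

definition dVa :: "'n::finite \<Rightarrow> real \<Rightarrow> (complex^'n) measure" where
  "dVa j0 \<alpha> = density lborel (\<lambda>z. indicator (TB j0) z * ennreal (rho j0 z powr \<alpha>))"

definition dVV :: "'n::finite \<Rightarrow> ((complex^'n) \<times> (complex^'n)) measure" where
  "dVV j0 = density (lborel \<Otimes>\<^sub>M lborel) (indicator (TB j0 \<times> TB j0))"

definition mixnorm_1inf :: "'n::finite \<Rightarrow> real \<Rightarrow> real \<Rightarrow> ((complex^'n) \<times> (complex^'n) \<Rightarrow> complex) \<Rightarrow> ennreal" where
  "mixnorm_1inf j0 \<alpha>1 \<alpha>2 f =
     esssup (dVa j0 \<alpha>2) (\<lambda>w. \<integral>\<^sup>+ z. ennreal (norm (f (z, w))) \<partial>(dVa j0 \<alpha>1))"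

definition Linf_norm :: "'n::finite \<Rightarrow> ((complex^'n) \<times> (complex^'n) \<Rightarrow> complex) \<Rightarrow> ennreal" where
  "Linf_norm j0 g = esssup (dVV j0) (\<lambda>x. ennreal (norm (g x)))"

definition op_integrand ::
  "(complex^'n \<Rightarrow> complex^'n \<Rightarrow> complex^'n \<Rightarrow> complex^'n \<Rightarrow> complex) \<Rightarrow> 'n::finite
    \<Rightarrow> ((complex^'n) \<times> (complex^'n) \<Rightarrow> complex) \<Rightarrow> (complex^'n) \<times> (complex^'n)
    \<Rightarrow> (complex^'n) \<times> (complex^'n) \<Rightarrow> complex" where
  "op_integrand K j0 f x y =
     indicator (TB j0 \<times> TB j0) y * K (fst x) (snd x) (fst y) (snd y) * f y"

definition op_apply ::
  "real \<Rightarrow> real \<Rightarrow> (complex^'n \<Rightarrow> complex^'n \<Rightarrow> complex^'n \<Rightarrow> complex^'n \<Rightarrow> complex) \<Rightarrow> 'n::finite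
    \<Rightarrow> ((complex^'n) \<times> (complex^'n) \<Rightarrow> complex) \<Rightarrow> (complex^'n) \<times> (complex^'n) \<Rightarrow> complex" where
  "op_apply a1 a2 K j0 f x =
     complex_of_real (rho j0 (fst x) powr a1 * rho j0 (snd x) powr a2) *
     (\<integral> y. op_integrand K j0 f x y \<partial>(lborel \<Otimes>\<^sub>M lborel))"

definition T_kernel :: "'n::finite \<Rightarrow> real \<Rightarrow> real \<Rightarrow> real \<Rightarrow> real
    \<Rightarrow> complex^'n \<Rightarrow> complex^'n \<Rightarrow> complex^'n \<Rightarrow> complex^'n \<Rightarrow> complex" where
  "T_kernel j0 b1 b2 c1 c2 z w u \<eta> =
     complex_of_real (rho j0 u powr b1 * rho j0 \<eta> powr b2) /
     (rho2 j0 z u powr complex_of_real c1 * rho2 j0 w \<eta> powr complex_of_real c2)"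

definition S_kernel :: "'n::finite \<Rightarrow> real \<Rightarrow> real \<Rightarrow> real \<Rightarrow> real
    \<Rightarrow> complex^'n \<Rightarrow> complex^'n \<Rightarrow> complex^'n \<Rightarrow> complex^'n \<Rightarrow> complex" where
  "S_kernel j0 b1 b2 c1 c2 z w u \<eta> =
     complex_of_real (rho j0 u powr b1 * rho j0 \<eta> powr b2 /
       (norm (rho2 j0 z u) powr c1 * norm (rho2 j0 w \<eta>) powr c2))"

definition bounded_1inf_to_inf ::
  "real \<Rightarrow> real \<Rightarrow> (complex^'n \<Rightarrow> complex^'n \<Rightarrow> complex^'n \<Rightarrow> complex^'n \<Rightarrow> complex) \<Rightarrow> 'n::finite
    \<Rightarrow> real \<Rightarrow> real \<Rightarrow> bool" where
  "bounded_1inf_to_inf a1 a2 K j0 \<alpha>1 \<alpha>2 \<longleftrightarrow>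
     (\<exists>C\<ge>0. \<forall>f. f \<in> borel_measurable (lborel \<Otimes>\<^sub>M lborel) \<and> mixnorm_1inf j0 \<alpha>1 \<alpha>2 f < \<infinity> \<longrightarrow>
        (AE x in dVV j0. integrable (lborel \<Otimes>\<^sub>M lborel) (op_integrand K j0 f x)) \<and>
        Linf_norm j0 (op_apply a1 a2 K j0 f) \<le> ennreal C * mixnorm_1inf j0 \<alpha>1 \<alpha>2 f)"

end

theory Submission
  imports Defs "HOL-Complex_Analysis.Cauchy_Integral_Theorem"
begin

text \<open>Since \<^term>\<open>T_kernel\<close> and \<^term>\<open>S_kernel\<close> have the same modulus, both operators are handled
  at once. If the operator is bounded, testing it on compactly supported functions carrying the
  conjugate phase of the kernel at a fixed point turns the almost everywhere bound into a pointwise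
  bound on the modulus of the kernel: the first factor, divided by the weight, is bounded in both
  variables, and the integral of the second factor is at most a constant times
  \<^term>\<open>rho j0 w powr - a2\<close>. Shears, translations and anisotropic dilations reduce this integral to a
  power of \<^term>\<open>rho j0 w\<close> times a constant, which is finite exactly for \<open>b2 > -1\<close> and
  \<open>c2 > n + 1 + b2\<close>; the remaining conditions come from homogeneity. Conversely, these bounds
  and Tonelli's theorem give boundedness.\<close>

text \<open>The choice of test functions rests on the asymmetry of the mixed norm: a function of
  modulus at most 1 supported in \<open>B \<times> E\<close> has norm at most the weighted volume of
  \<open>B\<close>, whatever \<open>E\<close> is. So \<open>B\<close> may shrink to a point, which
  extracts a supremum of the first factor, while \<open>E\<close> exhausts the domain, which
  extracts the full integral of the second. This is why the two pairs of exponents obey conditions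
  of different kinds. For T the obstacle is cancellation. The phase that removes it depends on the
  output point, and a single point is a null set, so an almost everywhere bound says nothing there
  until the image function is known to be continuous. The number n + 1 is the homogeneous dimension:
  scaling the last coordinate by t and the others by sqrt t multiplies Lebesgue measure by t^(n+1).
  The failure of convergence for small \<open>c2\<close> is not obtained by estimating a divergent
  integral, but by playing this scaling law against strict monotonicity in
  \<open>rho j0 w\<close>.\<close>

section \<open>The height \<open>rho\<close> and the kernel function \<open>rho2\<close>\<close>

lemma mem_TB_iff: "z \<in> TB j0 \<longleftrightarrow> 0 < rho j0 z"
  by (auto simp: TB_def rho_def)

text \<open>For a = z_j and b = u_j, the real part of (a - cnj b)^2 is (Re a - Re b)^2 - (Im a + Im
  b)^2. The parallelogram law for the imaginary parts turns this into |a - b|^2 minus 2 (Im a)^2 + 2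
  (Im b)^2, and the subtracted squares are exactly those contained in the two heights.\<close>

lemma Re_rho2:
  "4 * Re (rho2 j0 z u) = 2 * (rho j0 z + rho j0 u) + (\<Sum>j\<in>UNIV - {j0}. (cmod (z$j - u$j))\<^sup>2)"
proof -
  have "(\<Sum>j\<in>UNIV - {j0}. Re ((z$j - cnj (u$j))\<^sup>2)) + 2 * (\<Sum>j\<in>UNIV - {j0}. (Im (z$j))\<^sup>2)
     + 2 * (\<Sum>j\<in>UNIV - {j0}. (Im (u$j))\<^sup>2) = (\<Sum>j\<in>UNIV - {j0}. (cmod (z$j - u$j))\<^sup>2)"
    unfolding sum_distrib_left sum.distrib[symmetric]
    by (intro sum.cong refl) (simp add: cmod_power2, simp add: power2_eq_square algebra_simps)
  then show ?thesis
    by (simp add: rho2_def rho_def algebra_simps)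
qed

text \<open>The real part of the last coordinate of u enters only additively, so a shear in that
  coordinate can remove the mixed sum.\<close>

lemma Im_rho2:
  "4 * Im (rho2 j0 z u) =
    2 * (\<Sum>j\<in>UNIV - {j0}. (Re (z$j) - Re (u$j)) * (Im (z$j) + Im (u$j))) - 2 * (Re (z$j0) - Re (u$j0))"
proof -
  have "(\<Sum>j\<in>UNIV - {j0}. Im ((z$j - cnj (u$j))\<^sup>2)) =
    2 * (\<Sum>j\<in>UNIV - {j0}. (Re (z$j) - Re (u$j)) * (Im (z$j) + Im (u$j)))"
    unfolding sum_distrib_left
    by (intro sum.cong refl) (auto simp: power2_eq_square algebra_simps)
  then show ?thesis
    by (simp add: rho2_def algebra_simps)
qed

lemma Re_rho2_ge: "(rho j0 z + rho j0 u) / 2 \<le> Re (rho2 j0 z u)"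
  using Re_rho2[of j0 z u] sum_nonneg[of "UNIV - {j0}" "\<lambda>j. (cmod (z$j - u$j))\<^sup>2"] by auto

lemma norm_rho2_ge: "(rho j0 z + rho j0 u) / 2 \<le> cmod (rho2 j0 z u)"
  using Re_rho2_ge complex_Re_le_cmod order_trans by blast

lemma continuous_on_rho [continuous_intros]:
  "continuous_on A f \<Longrightarrow> continuous_on A (\<lambda>x. rho j0 (f x))"
  unfolding rho_def by (intro continuous_intros)

lemma continuous_on_rho2 [continuous_intros]:
  "continuous_on A f \<Longrightarrow> continuous_on A g \<Longrightarrow> continuous_on A (\<lambda>x. rho2 j0 (f x) (g x))"
  unfolding rho2_def by (intro continuous_intros)

lemma open_TB: "open (TB j0)"
proof -
  have "TB j0 = {z. 0 < rho j0 z}"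
    by (auto simp: mem_TB_iff)
  then show ?thesis
    by (auto intro!: open_Collect_less continuous_intros)
qed

lemma rho_measurable [measurable]: "rho j0 \<in> borel_measurable borel"
  by (intro borel_measurable_continuous_onI continuous_intros)

lemma rho2_measurable [measurable (raw)]:
  assumes [measurable]: "f \<in> borel_measurable M" "g \<in> borel_measurable M"
  shows "(\<lambda>x. rho2 j0 (f x) (g x)) \<in> borel_measurable M"
proof -
  have "(\<lambda>p. rho2 j0 (fst p) (snd p)) \<in> borel_measurable borel"
    by (intro borel_measurable_continuous_onI continuous_intros)
  from measurable_compose[OF _ this, of "\<lambda>x. (f x, g x)" M] show ?thesis
    by (simp add: borel_prod[symmetric])
qed

lemma sets_TB [measurable]: "TB j0 \<in> sets borel"
  by (rule borel_open[OF open_TB])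

section \<open>Invariance of Lebesgue measure\<close>

lemma nn_integral_lborel_translation:
  fixes F :: "'a::euclidean_space \<Rightarrow> ennreal"
  assumes [measurable]: "F \<in> borel_measurable borel"
  shows "(\<integral>\<^sup>+x. F (x + c) \<partial>lborel) = (\<integral>\<^sup>+x. F x \<partial>lborel)"
proof -
  have "(\<integral>\<^sup>+x. F x \<partial>lborel) = (\<integral>\<^sup>+x. F x \<partial>distr lborel borel ((+) c))"
    by (simp only: lborel_distr_plus)
  also have "\<dots> = (\<integral>\<^sup>+x. F (x + c) \<partial>lborel)"
    by (subst nn_integral_distr) (auto simp: add.commute)
  finally show ?thesis ..
qed

text \<open>A shear preserves Lebesgue measure: average over translations along the range of \<^term>\<open>L\<close>
  against the probability density \<^term>\<open>indicator (cbox 0 One)\<close>; this needs only translation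
  invariance and Tonelli.\<close>

lemma nn_integral_lborel_shear:
  fixes F :: "'a::euclidean_space \<Rightarrow> ennreal" and L :: "'b::euclidean_space \<Rightarrow> 'a" and \<phi> :: "'a \<Rightarrow> 'b"
  assumes [measurable]: "F \<in> borel_measurable borel" "L \<in> borel_measurable borel"
      "\<phi> \<in> borel_measurable borel"
    and L_add: "\<And>x y. L (x + y) = L x + L y"
    and \<phi>_inv: "\<And>x c. \<phi> (x + L c) = \<phi> x"
  shows "(\<integral>\<^sup>+x. F (x + L (\<phi> x)) \<partial>lborel) = (\<integral>\<^sup>+x. F x \<partial>lborel)"
proof -
  define \<psi> :: "'b \<Rightarrow> ennreal" where "\<psi> = indicator (cbox 0 One)"
  have [measurable]: "\<psi> \<in> borel_measurable borel"
    by (simp add: \<psi>_def)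
  have \<psi>_int: "(\<integral>\<^sup>+c. \<psi> (c + d) \<partial>lborel) = 1" for d
    by (subst nn_integral_lborel_translation) (simp_all add: \<psi>_def emeasure_lborel_cbox_eq)
  have "(\<integral>\<^sup>+x. F (x + L (\<phi> x)) \<partial>lborel) = (\<integral>\<^sup>+c. \<psi> (c + 0) * (\<integral>\<^sup>+x. F (x + L (\<phi> x)) \<partial>lborel) \<partial>lborel)"
    using \<psi>_int[of 0] by (subst nn_integral_multc) auto
  also have "\<dots> = (\<integral>\<^sup>+c. \<psi> c * (\<integral>\<^sup>+x. F (x + L c + L (\<phi> (x + L c))) \<partial>lborel) \<partial>lborel)"
    by (subst nn_integral_lborel_translation[where F="\<lambda>x. F (x + L (\<phi> x))"]) auto
  also have "\<dots> = (\<integral>\<^sup>+c. (\<integral>\<^sup>+x. \<psi> c * F (x + L (c + \<phi> x)) \<partial>lborel) \<partial>lborel)"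
    by (simp add: nn_integral_cmult \<phi>_inv L_add add.assoc)
  also have "\<dots> = (\<integral>\<^sup>+x. (\<integral>\<^sup>+c. \<psi> c * F (x + L (c + \<phi> x)) \<partial>lborel) \<partial>lborel)"
    by (rule lborel_pair.Fubini') measurable
  \<comment> \<open>Translating c by \<open>\<phi> x\<close> moves the shear from \<open>F\<close>
    into the density, whose integral is insensitive to translations.\<close>
  also have "\<dots> = (\<integral>\<^sup>+x. (\<integral>\<^sup>+c. \<psi> (c + - \<phi> x) * F (x + L c) \<partial>lborel) \<partial>lborel)"
  proof (rule nn_integral_cong)
    fix x
    show "(\<integral>\<^sup>+c. \<psi> c * F (x + L (c + \<phi> x)) \<partial>lborel) = (\<integral>\<^sup>+c. \<psi> (c + - \<phi> x) * F (x + L c) \<partial>lborel)"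
      using nn_integral_lborel_translation[of "\<lambda>c. \<psi> (c + - \<phi> x) * F (x + L c)" "\<phi> x"] by simp
  qed
  \<comment> \<open>By invariance, \<open>\<phi> x\<close> may be written
    \<open>\<phi> (x + L c)\<close>. For fixed c the integrand is then a function of
    \<open>x + L c\<close>, and translation in x removes \<open>L c\<close>.\<close>
  also have "\<dots> = (\<integral>\<^sup>+c. (\<integral>\<^sup>+x. \<psi> (c + - \<phi> (x + L c)) * F (x + L c) \<partial>lborel) \<partial>lborel)"
    unfolding \<phi>_inv by (rule lborel_pair.Fubini') measurable
  also have "\<dots> = (\<integral>\<^sup>+c. (\<integral>\<^sup>+x. \<psi> (c + - \<phi> x) * F x \<partial>lborel) \<partial>lborel)"
  proof (rule nn_integral_cong)
    fix c
    show "(\<integral>\<^sup>+x. \<psi> (c + - \<phi> (x + L c)) * F (x + L c) \<partial>lborel) = (\<integral>\<^sup>+x. \<psi> (c + - \<phi> x) * F x \<partial>lborel)"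
      by (rule nn_integral_lborel_translation) measurable
  qed
  also have "\<dots> = (\<integral>\<^sup>+x. (\<integral>\<^sup>+c. \<psi> (c + - \<phi> x) * F x \<partial>lborel) \<partial>lborel)"
    by (rule lborel_pair.Fubini') measurable
  also have "\<dots> = (\<integral>\<^sup>+x. F x \<partial>lborel)"
    by (subst nn_integral_multc) (auto simp: \<psi>_int simp del: add_uminus_conv_diff)
  finally show ?thesis .
qed

text \<open>A negligible set contains no nonempty open set. This is the means of passing from almost
  everywhere statements to actual points; the completed measure is used because the exceptional set
  need not be Borel.\<close>

lemma AE_lborel_open_ex:
  fixes U :: "'a::euclidean_space set"
  assumes "AE x in lborel. P x" "open U" "U \<noteq> {}"
  shows "\<exists>x\<in>U. P x"
proof (rule ccontr)
  assume "\<not> (\<exists>x\<in>U. P x)"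
  moreover have "AE x in lebesgue. P x"
    using assms(1) by (rule AE_completion)
  then obtain N where "N \<in> null_sets lebesgue" "{x. \<not> P x} \<subseteq> N"
    unfolding eventually_ae_filter by auto
  ultimately have "negligible U"
    using negligible_subset[of N U] by (auto simp: negligible_iff_null_sets)
  then show False
    using open_not_negligible assms by blast
qed

section \<open>One-dimensional integrals\<close>

lemma nn_integral_powr_unit_finite:
  fixes b :: real
  assumes "b > -1"
  shows "(\<integral>\<^sup>+x. ennreal (x powr b) * indicator {0..1} x \<partial>lborel) < \<infinity>"
  using nn_integral_has_integral_lebesgue'[OF _ has_integral_powr_from_0[OF assms, of 1]] by simp

lemma nn_integral_powr_tail_finite:
  fixes p :: real
  assumes "p > 1"
  shows "(\<integral>\<^sup>+x. ennreal (x powr - p) * indicator {1..} x \<partial>lborel) < \<infinity>"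
  using nn_integral_has_integral_lebesgue'[OF _ has_integral_powr_to_inf[of "-p" 1]] assms by simp

lemma nn_integral_powr_unit_infinite:
  fixes b :: real
  assumes "b \<le> -1"
  shows "(\<integral>\<^sup>+x. ennreal (x powr b) * indicator {0<..1} x \<partial>lborel) = \<infinity>"
proof -
  have "ennreal (real k) \<le> (\<integral>\<^sup>+x. ennreal (x powr b) * indicator {0<..1} x \<partial>lborel)" for k
  proof -
    \<comment> \<open>With this lower limit the integral of 1/x over [e, 1] is exactly k, and b
      \<le> -1 makes 1/x a minorant of \<open>x powr b\<close> there.\<close>
    define e where "e = exp (- real k)"
    have e: "0 < e" "e \<le> 1" "ln e = - real k" by (auto simp: e_def)
    have "((\<lambda>x. 1 / x) has_integral (ln 1 - ln e)) {e..1}"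
      using e by (intro fundamental_theorem_of_calculus)
        (auto intro!: derivative_eq_intros simp flip: has_real_derivative_iff_has_vector_derivative)
    then have "ennreal (real k) = (\<integral>\<^sup>+x. ennreal (1 / x) * indicator {e..1} x \<partial>lborel)"
      using nn_integral_has_integral_lebesgue'[of "{e..1}" "\<lambda>x. 1 / x"] e by auto
    also have "\<dots> \<le> (\<integral>\<^sup>+x. ennreal (x powr b) * indicator {0<..1} x \<partial>lborel)"
    proof (intro nn_integral_mono)
      fix x :: real
      have "1 / x \<le> x powr b" if "e \<le> x" "x \<le> 1"
      proof -
        have "x powr (-1) \<le> x powr b"
          using that e assms by (intro powr_mono') auto
        then show ?thesis
          using that e by (simp add: powr_minus_divide)
      qed
      then show "ennreal (1 / x) * indicator {e..1} x \<le> ennreal (x powr b) * indicator {0<..1} x"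
        using e by (auto simp: indicator_def intro!: ennreal_leI)
    qed
    finally show ?thesis .
  qed
  moreover have "\<exists>k. x < ennreal (real k)" if "x < \<infinity>" for x
    using that by (cases x) (auto intro!: reals_Archimedean2 simp: ennreal_less_iff)
  ultimately show ?thesis
    by (metis linorder_not_le top.not_eq_extremum infinity_ennreal_def)
qed

lemma nn_integral_one_plus_abs_powr_finite:
  fixes p :: real
  assumes "p > 1"
  shows "(\<integral>\<^sup>+x. ennreal ((1 + \<bar>x\<bar>) powr - p) \<partial>lborel) < \<infinity>"
proof -
  let ?t = "\<lambda>x. ennreal (x powr - p) * indicator {1..} x"
  have "(\<integral>\<^sup>+x. ennreal ((1 + \<bar>x\<bar>) powr - p) \<partial>lborel)
      \<le> (\<integral>\<^sup>+x. indicator {-1..1} x + (?t x + ?t (-x)) \<partial>lborel)"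
  proof (intro nn_integral_mono)
    fix x :: real
    have 1: "(1 + \<bar>x\<bar>) powr - p \<le> 1"
      using assms powr_mono[of "-p" 0 "1 + \<bar>x\<bar>"] by (auto split: if_splits)
    have 2: "(1 + \<bar>x\<bar>) powr - p \<le> \<bar>x\<bar> powr - p" if "x \<noteq> 0"
      using assms that by (intro powr_mono2') auto
    consider "\<bar>x\<bar> \<le> 1" | "x > 1" | "x < -1" by linarith
    then show "ennreal ((1 + \<bar>x\<bar>) powr - p) \<le> indicator {-1..1} x + (?t x + ?t (-x))"
    proof cases
      case 1
      then have "ennreal ((1 + \<bar>x\<bar>) powr - p) \<le> indicator {-1..1} x"
        using \<open>(1 + \<bar>x\<bar>) powr - p \<le> 1\<close> by (auto simp: indicator_def)
      then show ?thesis by (rule order_trans) simp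
    next
      case 2
      then show ?thesis using \<open>x \<noteq> 0 \<Longrightarrow> _\<close>
        by (auto simp: indicator_def intro!: ennreal_leI)
    next
      case 3
      then show ?thesis using \<open>x \<noteq> 0 \<Longrightarrow> _\<close>
        by (auto simp: indicator_def intro!: ennreal_leI)
    qed
  qed
  also have "\<dots> = 2 + ((\<integral>\<^sup>+x. ?t x \<partial>lborel) + (\<integral>\<^sup>+x. ?t (- x) \<partial>lborel))"
    by (simp add: nn_integral_add)
  also have "(\<integral>\<^sup>+x. ?t (- x) \<partial>lborel) = (\<integral>\<^sup>+x. ?t x \<partial>lborel)"
    using nn_integral_real_affine[of ?t "-1" 0] by simp
  also have "2 + ((\<integral>\<^sup>+x. ?t x \<partial>lborel) + (\<integral>\<^sup>+x. ?t x \<partial>lborel)) < \<infinity>"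
    using nn_integral_powr_tail_finite[OF assms] by auto
  finally show ?thesis .
qed

text \<open>This is the Beta integral B(b + 1, e): the integrand is at most x^b near 0 and at most
  x^(-1-e) near infinity.\<close>

lemma nn_integral_powr_beta_finite:
  fixes b e :: real
  assumes "b > -1" "e > 0"
  shows "(\<integral>\<^sup>+x. indicator {0<..} x * ennreal (x powr b * (1 + x) powr - (b + 1 + e)) \<partial>lborel) < \<infinity>"
proof -
  have "(\<integral>\<^sup>+x. indicator {0<..} x * ennreal (x powr b * (1 + x) powr - (b + 1 + e)) \<partial>lborel)
     \<le> (\<integral>\<^sup>+x. ennreal (x powr b) * indicator {0..1} x + ennreal (x powr - (1 + e)) * indicator {1..} x \<partial>lborel)"
  proof (intro nn_integral_mono)
    fix x :: real
    show "indicator {0<..} x * ennreal (x powr b * (1 + x) powr - (b + 1 + e))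
       \<le> ennreal (x powr b) * indicator {0..1} x + ennreal (x powr - (1 + e)) * indicator {1..} x"
    proof -
      consider "x \<le> 0" | "0 < x" "x \<le> 1" | "x > 1" by linarith
      then show ?thesis
      proof cases
        case 2
        have "(1 + x) powr - (b + 1 + e) \<le> 1"
          using assms 2 powr_mono[of "- (b + 1 + e)" 0 "1 + x"] by simp
        then have "x powr b * (1 + x) powr - (b + 1 + e) \<le> x powr b"
          by (simp add: mult_left_le)
        then have "indicator {0<..} x * ennreal (x powr b * (1 + x) powr - (b + 1 + e))
           \<le> ennreal (x powr b) * indicator {0..1} x"
          using 2 by (auto simp: indicator_def intro!: ennreal_leI)
        then show ?thesis by (rule order_trans) simp
      next
        case 3
        have "(1 + x) powr - (b + 1 + e) \<le> x powr - (b + 1 + e)"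
          using assms 3 by (intro powr_mono2') auto
        then have "x powr b * (1 + x) powr - (b + 1 + e) \<le> x powr b * x powr - (b + 1 + e)"
          by (intro mult_left_mono) auto
        also have "\<dots> = x powr - (1 + e)"
          by (simp add: powr_add[symmetric])
        finally show ?thesis
          using 3 by (auto simp: indicator_def intro!: ennreal_leI)
      qed auto
    qed
  qed
  also have "\<dots> < \<infinity>"
    using nn_integral_powr_tail_finite[of "1 + e"] nn_integral_powr_unit_finite[of b] assms
    by (subst nn_integral_add) auto
  finally show ?thesis .
qed

section \<open>Coordinates and dilations\<close>

lemma inner_axis_1: "(x::complex^'n) \<bullet> axis j 1 = Re (x $ j)"
  by (simp add: inner_axis inner_complex_def)

lemma inner_axis_ii: "(x::complex^'n) \<bullet> axis j \<i> = Im (x $ j)"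
  by (simp add: inner_axis inner_complex_def)

lemma Basis_complex_vec: "Basis = (\<Union>j. {axis j 1, axis j \<i> :: complex^'n})"
  by (auto simp: Basis_vec_def Basis_complex_def)

lemma card_Basis_complex_vec: "card (Basis :: (complex^'n) set) = 2 * CARD('n)"
  by (simp add: mult.commute)

lemma axis_complex_eq_iff:
  "axis j (1::complex) = axis k 1 \<longleftrightarrow> j = k" "axis j \<i> = axis k \<i> \<longleftrightarrow> j = k"
  "axis j (1::complex) \<noteq> axis k \<i>" "axis j \<i> \<noteq> axis k 1"
  by (auto simp: axis_eq_axis)

lemma Basis_complex_vec_cases:
  fixes \<beta> :: "complex^'n"
  assumes "\<beta> \<in> Basis"
  obtains "\<beta> = axis j0 \<i>" | "\<beta> = axis j0 1" | j where "j \<noteq> j0" "\<beta> \<in> {axis j 1, axis j \<i>}"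
proof -
  obtain j where "\<beta> \<in> {axis j 1, axis j \<i>}"
    using assms unfolding Basis_complex_vec by auto
  then show ?thesis
    using that by (cases "j = j0") auto
qed

text \<open>The two real coordinates of the last complex variable, the imaginary one first, are
  split off because they scale with weight 1, while all other coordinates scale with weight
  1/2.\<close>

lemma prod_Basis_split:
  fixes j0 :: "'n::finite" and f :: "complex^'n \<Rightarrow> 'a::comm_monoid_mult"
  shows "prod f Basis = f (axis j0 \<i>) * f (axis j0 1) * prod f (Basis - {axis j0 \<i>, axis j0 1})"
proof -
  have "prod f Basis = prod f {axis j0 \<i>, axis j0 1} * prod f (Basis - {axis j0 \<i>, axis j0 1})"
    by (subst mult.commute, rule prod.subset_diff) (auto simp: Basis_complex_vec)
  then show ?thesis by (simp add: axis_complex_eq_iff)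
qed

lemma sum_Basis_split:
  fixes j0 :: "'n::finite" and f :: "complex^'n \<Rightarrow> 'a::ab_group_add"
  shows "sum f Basis = f (axis j0 \<i>) + f (axis j0 1) + sum f (Basis - {axis j0 \<i>, axis j0 1})"
proof -
  have "sum f Basis = sum f {axis j0 \<i>, axis j0 1} + sum f (Basis - {axis j0 \<i>, axis j0 1})"
    by (subst add.commute, rule sum.subset_diff) (auto simp: Basis_complex_vec)
  then show ?thesis by (simp add: axis_complex_eq_iff)
qed

lemma card_Basis_complex_vec_rest:
  "card (Basis - {axis j0 \<i>, axis j0 1 :: complex^'n}) = 2 * (CARD('n) - 1)"
proof (subst card_Diff_subset)
  show "{axis j0 \<i>, axis j0 1 :: complex^'n} \<subseteq> Basis"
    by (auto simp: Basis_complex_vec)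
qed (simp_all only: card_Basis_complex_vec, simp_all add: axis_complex_eq_iff)

text \<open>The Jacobian is t * t from the two real coordinates at \<open>j0\<close>, times (sqrt
  t)^(2(n-1)) = t^(n-1) from the others.\<close>

lemma nn_integral_anisotropic_scaling:
  fixes j0 :: "'n::finite" and F :: "complex^'n \<Rightarrow> ennreal"
  assumes [measurable]: "F \<in> borel_measurable borel" and t: "t > 0"
  shows "(\<integral>\<^sup>+x. F x \<partial>lborel) = ennreal (t ^ (CARD('n) + 1)) *
    (\<integral>\<^sup>+x. F (\<chi> j. if j = j0 then of_real t * x$j else of_real (sqrt t) * x$j) \<partial>lborel)"
proof -
  define c :: "complex^'n \<Rightarrow> real" where "c \<beta> = (if \<beta> \<in> {axis j0 \<i>, axis j0 1} then t else sqrt t)" for \<beta>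
  \<comment> \<open>The summand 0 is the translation part in the general form of an affine change of
    variables, to which \<open>lborel_affine_euclidean\<close> applies.\<close>
  define T :: "complex^'n \<Rightarrow> complex^'n" where "T x = 0 + (\<Sum>\<beta>\<in>Basis. (c \<beta> * (x \<bullet> \<beta>)) *\<^sub>R \<beta>)" for x
  have T_inner: "T x \<bullet> \<beta> = c \<beta> * (x \<bullet> \<beta>)" if "\<beta> \<in> Basis" for x \<beta>
    using that by (simp add: T_def)
  have T: "T x = (\<chi> j. if j = j0 then of_real t * x$j else of_real (sqrt t) * x$j)" for x
  proof (subst vec_eq_iff, intro allI)
    fix j
    show "T x $ j = (\<chi> j. if j = j0 then of_real t * x$j else of_real (sqrt t) * x$j) $ j"
      using T_inner[of "axis j 1" x] T_inner[of "axis j \<i>" x]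
      by (auto simp: Basis_complex_vec inner_axis_1 inner_axis_ii c_def axis_complex_eq_iff complex_eq_iff)
  qed
  have T_meas [measurable]: "T \<in> borel_measurable borel"
    unfolding T_def by measurable
  have "(\<Prod>\<beta>\<in>Basis. \<bar>c \<beta>\<bar>) = t * t * (\<Prod>\<beta>\<in>Basis - {axis j0 \<i>, axis j0 1 :: complex^'n}. sqrt t)"
    unfolding prod_Basis_split[of _ j0] using t by (intro arg_cong2[of _ _ _ _ "(*)"] prod.cong) (auto simp: c_def)
  also have "(\<Prod>\<beta>\<in>Basis - {axis j0 \<i>, axis j0 1 :: complex^'n}. sqrt t) = t ^ (CARD('n) - 1)"
    using t card_Basis_complex_vec_rest[of j0] by (simp add: power_mult)
  also have "t * t * t ^ (CARD('n) - 1) = t ^ (CARD('n) + 1)"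
    using power_minus_mult[of "CARD('n)" t] by (simp add: mult_ac)
  finally have prod: "(\<Prod>\<beta>\<in>Basis. \<bar>c \<beta>\<bar>) = t ^ (CARD('n) + 1)" .
  have "lborel = density (distr lborel borel T) (\<lambda>_. ennreal (\<Prod>\<beta>\<in>Basis. \<bar>c \<beta>\<bar>))"
    unfolding T_def[abs_def] by (rule lborel_affine_euclidean) (use t in \<open>auto simp: c_def\<close>)
  then have "(\<integral>\<^sup>+x. F x \<partial>lborel) = (\<integral>\<^sup>+x. F x \<partial>density (distr lborel borel T) (\<lambda>_. ennreal (t ^ (CARD('n) + 1))))"
    unfolding prod by simp
  also have "\<dots> = ennreal (t ^ (CARD('n) + 1)) * (\<integral>\<^sup>+x. F (T x) \<partial>lborel)"
    by (simp add: nn_integral_density nn_integral_distr nn_integral_cmult)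
  finally show ?thesis
    unfolding T .
qed

section \<open>The integral of the kernel\<close>

definition kernel_integral :: "'n::finite \<Rightarrow> real \<Rightarrow> real \<Rightarrow> complex^'n \<Rightarrow> ennreal" where
  "kernel_integral j0 b c w =
    (\<integral>\<^sup>+\<eta>. indicator (TB j0) \<eta> * ennreal (rho j0 \<eta> powr b / cmod (rho2 j0 w \<eta>) powr c) \<partial>lborel)"

text \<open>This is the modulus of \<open>rho2 j0 w\<close> in the straightened coordinates, where
  \<open>w\<close> survives only through its height \<open>r\<close>.\<close>

definition flat_norm :: "'n::finite \<Rightarrow> real \<Rightarrow> complex^'n \<Rightarrow> real" where
  "flat_norm j0 r \<eta> =
    cmod (Complex (2 * r + 2 * Im (\<eta>$j0) + (\<Sum>j\<in>UNIV - {j0}. (cmod (\<eta>$j))\<^sup>2)) (2 * Re (\<eta>$j0))) / 4"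

definition flat_integral :: "'n::finite \<Rightarrow> real \<Rightarrow> real \<Rightarrow> real \<Rightarrow> ennreal" where
  "flat_integral j0 b c r =
    (\<integral>\<^sup>+\<eta>. indicator {\<eta>. 0 < Im (\<eta>$j0)} \<eta> * ennreal (Im (\<eta>$j0) powr b / flat_norm j0 r \<eta> powr c) \<partial>lborel)"

lemma vec_nth_measurable [measurable (raw)]:
  fixes f :: "'a \<Rightarrow> complex^'n"
  assumes "f \<in> borel_measurable M"
  shows "(\<lambda>x. f x $ j) \<in> borel_measurable M"
  by (rule measurable_compose[OF assms])
     (intro borel_measurable_continuous_onI continuous_intros)

lemma flat_norm_eq_sqrt:
  "flat_norm j0 r \<eta> =
    sqrt ((2 * r + 2 * Im (\<eta>$j0) + (\<Sum>j\<in>UNIV - {j0}. (cmod (\<eta>$j))\<^sup>2))\<^sup>2 + (2 * Re (\<eta>$j0))\<^sup>2) / 4"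
  by (simp add: flat_norm_def complex_norm)

lemma flat_norm_measurable [measurable]: "flat_norm j0 r \<in> borel_measurable borel"
  unfolding flat_norm_eq_sqrt[abs_def] by measurable

lemma flat_norm_ge:
  shows "r / 2 + Im (\<eta>$j0) / 2 + (\<Sum>j\<in>UNIV - {j0}. (cmod (\<eta>$j))\<^sup>2) / 4 \<le> flat_norm j0 r \<eta>"
    and "\<bar>Re (\<eta>$j0)\<bar> / 2 \<le> flat_norm j0 r \<eta>"
proof -
  let ?C = "Complex (2 * r + 2 * Im (\<eta>$j0) + (\<Sum>j\<in>UNIV - {j0}. (cmod (\<eta>$j))\<^sup>2)) (2 * Re (\<eta>$j0))"
  have "Re ?C \<le> cmod ?C" "\<bar>Im ?C\<bar> \<le> cmod ?C"
    by (rule complex_Re_le_cmod, rule abs_Im_le_cmod)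
  moreover have "flat_norm j0 r \<eta> = cmod ?C / 4"
    by (simp add: flat_norm_def)
  ultimately show "r / 2 + Im (\<eta>$j0) / 2 + (\<Sum>j\<in>UNIV - {j0}. (cmod (\<eta>$j))\<^sup>2) / 4 \<le> flat_norm j0 r \<eta>"
    and "\<bar>Re (\<eta>$j0)\<bar> / 2 \<le> flat_norm j0 r \<eta>"
    unfolding complex.sel by linarith+
qed

lemma flat_norm_gt_half:
  assumes "0 < Im (\<eta>$j0)"
  shows "r / 2 < flat_norm j0 r \<eta>"
  using flat_norm_ge(1)[of r \<eta> j0] sum_nonneg[of "UNIV - {j0}" "\<lambda>j. (cmod (\<eta>$j))\<^sup>2"] assms by auto

lemma rho_add_shear:
  fixes \<eta> :: "complex^'n"
  assumes "Im s = (\<Sum>j\<in>UNIV - {j0}. (Im (\<eta>$j))\<^sup>2)"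
  shows "rho j0 (\<eta> + axis j0 s) = Im (\<eta>$j0)"
  using assms by (simp add: rho_def axis_def)

text \<open>Straightening the domain: the shear in the last coordinate turns \<^term>\<open>rho j0\<close> into the
  height above a hyperplane, and its real part is chosen to cancel the imaginary part of
  \<^term>\<open>rho2 j0 w\<close> up to a linear term.\<close>

lemma kernel_integral_eq_flat:
  fixes w :: "complex^'n::finite"
  shows "kernel_integral j0 b c w = flat_integral j0 b c (rho j0 w)"
proof -
  define F where "F \<eta> = indicator (TB j0) \<eta> * ennreal (rho j0 \<eta> powr b / cmod (rho2 j0 w \<eta>) powr c)" for \<eta>
  \<comment> \<open>The imaginary part lifts the half-space to the domain. The real part solves the
    formula of \<open>Im_rho2\<close> for the last coordinate, so that only a multiple of
    \<open>Re (\<eta>$j0)\<close> is left.\<close>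
  define \<phi> where "\<phi> \<eta> = Complex (Re (w$j0) - (\<Sum>j\<in>UNIV - {j0}. (Re (w$j) - Re (\<eta>$j)) * (Im (w$j) + Im (\<eta>$j))))
    (\<Sum>j\<in>UNIV - {j0}. (Im (\<eta>$j))\<^sup>2)" for \<eta> :: "complex^'n"
  \<comment> \<open>This translation centres the remaining coordinates at \<open>w\<close>. Its last
    entry is 0 because \<open>\<phi>\<close> already contains \<open>Re (w$j0)\<close> and the
    height of \<open>w\<close> stays as the parameter.\<close>
  define w' where "w' = (\<chi> j. if j = j0 then 0 else w$j)"
  have [measurable]: "F \<in> borel_measurable borel"
    unfolding F_def by measurable
  have \<phi>_meas [measurable]: "\<phi> \<in> borel_measurable borel"
    unfolding \<phi>_def Complex_eq by measurable
  have [measurable]: "(axis j0 :: complex \<Rightarrow> complex^'n) \<in> borel_measurable borel"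
    by (intro borel_measurable_continuous_onI linear_continuous_on linear_conv_bounded_linear[THEN iffD1] linearI)
       (auto simp: axis_def vec_eq_iff)
  have \<phi>_inv: "\<phi> (\<eta> + axis j0 s) = \<phi> \<eta>" for \<eta> s
    unfolding \<phi>_def by (intro arg_cong2[of _ _ _ _ Complex] arg_cong2[of _ _ _ _ minus] refl sum.cong) (auto simp: axis_def)
  have axis_add: "axis j0 (s + t) = (axis j0 s + axis j0 t :: complex^'n)" for s t
    by (simp add: axis_def vec_eq_iff)
  have "kernel_integral j0 b c w = (\<integral>\<^sup>+\<eta>. F (\<eta> + axis j0 (\<phi> \<eta>)) \<partial>lborel)"
    unfolding kernel_integral_def F_def[symmetric]
    by (rule nn_integral_lborel_shear[where L="axis j0", symmetric])
       (simp_all add: \<phi>_inv axis_add)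
  also have "\<dots> = (\<integral>\<^sup>+\<eta>. F ((\<eta> + w') + axis j0 (\<phi> (\<eta> + w'))) \<partial>lborel)"
    by (rule nn_integral_lborel_translation[symmetric]) measurable
  also have "\<dots> = flat_integral j0 b c (rho j0 w)"
    unfolding flat_integral_def
  proof (rule nn_integral_cong)
    fix \<eta> :: "complex^'n"
    define \<xi> where "\<xi> = (\<eta> + w') + axis j0 (\<phi> (\<eta> + w'))"
    have \<xi>0: "\<xi>$j0 = \<eta>$j0 + \<phi> (\<eta> + w')"
      by (simp add: \<xi>_def w'_def)
    have \<xi>j: "\<xi>$j = \<eta>$j + w$j" if "j \<noteq> j0" for j
      using that by (simp add: \<xi>_def w'_def axis_def)
    have rho: "rho j0 \<xi> = Im (\<eta>$j0)"
      unfolding \<xi>_def by (subst rho_add_shear) (auto simp: \<phi>_def w'_def)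
    have "4 * Re (rho2 j0 w \<xi>) = 2 * rho j0 w + 2 * Im (\<eta>$j0) + (\<Sum>j\<in>UNIV - {j0}. (cmod (\<eta>$j))\<^sup>2)"
    proof -
      have "(\<Sum>j\<in>UNIV - {j0}. (cmod (w$j - \<xi>$j))\<^sup>2) = (\<Sum>j\<in>UNIV - {j0}. (cmod (\<eta>$j))\<^sup>2)"
        by (intro sum.cong) (auto simp: \<xi>j)
      then show ?thesis
        by (simp add: Re_rho2 rho)
    qed
    moreover have "4 * Im (rho2 j0 w \<xi>) = 2 * Re (\<eta>$j0)"
    proof -
      have "(\<Sum>j\<in>UNIV - {j0}. (Re (w$j) - Re (\<xi>$j)) * (Im (w$j) + Im (\<xi>$j)))
        = (\<Sum>j\<in>UNIV - {j0}. (Re (w$j) - Re ((\<eta> + w')$j)) * (Im (w$j) + Im ((\<eta> + w')$j)))"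
        by (intro sum.cong) (auto simp: \<xi>j w'_def)
      then show ?thesis
        unfolding Im_rho2 \<xi>0 \<phi>_def by simp
    qed
    ultimately have "4 * rho2 j0 w \<xi> = Complex (2 * rho j0 w + 2 * Im (\<eta>$j0) + (\<Sum>j\<in>UNIV - {j0}. (cmod (\<eta>$j))\<^sup>2)) (2 * Re (\<eta>$j0))"
      by (simp add: complex_eq_iff)
    then have "cmod (rho2 j0 w \<xi>) = flat_norm j0 (rho j0 w) \<eta>"
      by (metis flat_norm_def nonzero_mult_div_cancel_left norm_mult norm_numeral zero_neq_numeral)
    then show "F ((\<eta> + w') + axis j0 (\<phi> (\<eta> + w'))) = indicator {\<eta>. 0 < Im (\<eta>$j0)} \<eta> *
        ennreal (Im (\<eta>$j0) powr b / flat_norm j0 (rho j0 w) \<eta> powr c)"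
      unfolding \<xi>_def[symmetric] F_def by (auto simp: rho indicator_def mem_TB_iff)
  qed
  finally show ?thesis .
qed

text \<open>\<open>flat_norm\<close> is homogeneous of degree 1 when \<open>r\<close> and the
  anisotropic dilation are scaled together. The exponent collects n + 1 from the measure, b from the
  height and -c from the kernel.\<close>

lemma flat_integral_scale:
  fixes j0 :: "'n::finite"
  assumes "t > 0"
  shows "flat_integral j0 b c (t * r) = ennreal (t powr (real CARD('n) + 1 + b - c)) * flat_integral j0 b c r"
proof -
  define D :: "complex^'n \<Rightarrow> complex^'n" where
    "D x = (\<chi> j. if j = j0 then of_real t * x$j else of_real (sqrt t) * x$j)" for x
  have fn: "flat_norm j0 (t * r) (D \<eta>) = t * flat_norm j0 r \<eta>" for \<eta>
  proof -
    have "Complex (2 * (t * r) + 2 * Im (D \<eta>$j0) + (\<Sum>j\<in>UNIV - {j0}. (cmod (D \<eta>$j))\<^sup>2)) (2 * Re (D \<eta>$j0))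
      = of_real t * Complex (2 * r + 2 * Im (\<eta>$j0) + (\<Sum>j\<in>UNIV - {j0}. (cmod (\<eta>$j))\<^sup>2)) (2 * Re (\<eta>$j0))"
      using assms by (auto simp: D_def complex_eq_iff norm_mult power_mult_distrib sum_distrib_left algebra_simps intro!: sum.cong)
    then show ?thesis
      unfolding flat_norm_def using assms by (simp add: norm_mult)
  qed
  have "flat_integral j0 b c (t * r) = ennreal (t ^ (CARD('n) + 1)) *
    (\<integral>\<^sup>+\<eta>. indicator {\<eta>. 0 < Im (\<eta>$j0)} (D \<eta>) * ennreal (Im (D \<eta>$j0) powr b / flat_norm j0 (t * r) (D \<eta>) powr c) \<partial>lborel)"
    unfolding flat_integral_def D_def
    by (rule nn_integral_anisotropic_scaling) (use assms in measurable)
  also have "(\<integral>\<^sup>+\<eta>. indicator {\<eta>. 0 < Im (\<eta>$j0)} (D \<eta>) * ennreal (Im (D \<eta>$j0) powr b / flat_norm j0 (t * r) (D \<eta>) powr c) \<partial>lborel)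
    = (\<integral>\<^sup>+\<eta>. ennreal (t powr (b - c)) * (indicator {\<eta>. 0 < Im (\<eta>$j0)} \<eta> *
        ennreal (Im (\<eta>$j0) powr b / flat_norm j0 r \<eta> powr c)) \<partial>lborel)"
  proof (rule nn_integral_cong)
    fix \<eta> :: "complex^'n"
    have *: "Im (D \<eta>$j0) = t * Im (\<eta>$j0)"
      by (simp add: D_def)
    have "flat_norm j0 r \<eta> \<ge> 0"
      by (simp add: flat_norm_def)
    then have "Im (D \<eta>$j0) powr b / flat_norm j0 (t * r) (D \<eta>) powr c
      = t powr (b - c) * (Im (\<eta>$j0) powr b / flat_norm j0 r \<eta> powr c)" if "0 < Im (\<eta>$j0)"
      using that assms unfolding * fn by (simp add: powr_mult powr_diff)
    then show "indicator {\<eta>. 0 < Im (\<eta>$j0)} (D \<eta>) * ennreal (Im (D \<eta>$j0) powr b / flat_norm j0 (t * r) (D \<eta>) powr c)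
      = ennreal (t powr (b - c)) * (indicator {\<eta>. 0 < Im (\<eta>$j0)} \<eta> *
        ennreal (Im (\<eta>$j0) powr b / flat_norm j0 r \<eta> powr c))"
      using assms * by (auto simp: indicator_def zero_less_mult_iff simp flip: ennreal_mult')
  qed
  also have "\<dots> = ennreal (t powr (b - c)) * flat_integral j0 b c r"
    unfolding flat_integral_def by (rule nn_integral_cmult) measurable
  also have "ennreal (t ^ (CARD('n) + 1)) * (ennreal (t powr (b - c)) * flat_integral j0 b c r)
    = ennreal (t ^ (CARD('n) + 1) * t powr (b - c)) * flat_integral j0 b c r"
    using assms by (simp add: ennreal_mult mult.assoc)
  also have "t ^ (CARD('n) + 1) * t powr (b - c) = t powr (real (CARD('n) + 1) + (b - c))"
    using assms by (simp only: powr_add powr_realpow)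
  finally show ?thesis
    by (simp add: algebra_simps)
qed

section \<open>The exact range of exponents in which the flat integral converges\<close>

lemma open_half_space: "open {\<eta>::complex^'n. 0 < Im (\<eta>$j0)}"
  by (intro open_Collect_less continuous_intros)

lemma half_space_nonempty: "{\<eta>::complex^'n. 0 < Im (\<eta>$j0)} \<noteq> {}"
proof -
  have "axis j0 \<i> \<in> {\<eta>::complex^'n. 0 < Im (\<eta>$j0)}" by simp
  then show ?thesis by blast
qed

lemma flat_integral_pos:
  fixes j0 :: "'n::finite"
  assumes "r > 0"
  shows "flat_integral j0 b c r > 0"
proof (rule ccontr)
  assume "\<not> ?thesis"
  then have "AE \<eta> in lborel. indicator {\<eta>. 0 < Im (\<eta>$j0)} \<eta> * ennreal (Im (\<eta>$j0) powr b / flat_norm j0 r \<eta> powr c) = 0"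
    unfolding flat_integral_def by (subst (asm) not_gr_zero, subst (asm) nn_integral_0_iff_AE) auto
  from AE_lborel_open_ex[OF this open_half_space[of j0] half_space_nonempty]
  obtain \<eta> :: "complex^'n" where "0 < Im (\<eta>$j0)" "ennreal (Im (\<eta>$j0) powr b / flat_norm j0 r \<eta> powr c) = 0"
    by auto
  then show False
    using flat_norm_gt_half[of \<eta> j0 r] assms by (auto simp: ennreal_eq_0_iff divide_le_0_iff powr_eq_0_iff not_le split: if_splits)
qed

text \<open>The exponent c is distributed over the 2n real coordinates, so that the integrand is
  dominated by a product of functions of one variable, each with an exponent slightly beyond its
  critical value.\<close>

lemma flat_integral_finite:
  fixes j0 :: "'n::finite"
  assumes b: "b > -1" and c: "c > real CARD('n) + 1 + b"
  shows "flat_integral j0 b c 1 < \<infinity>"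
proof -
  \<comment> \<open>The excess of c over n + 1 + b is shared equally by the 2n real
    coordinates.\<close>
  define e where "e = (c - b - real CARD('n) - 1) / (2 * real CARD('n))"
  have card_pos: "real CARD('n) \<ge> 1"
    using zero_less_card_finite[where 'a='n] by linarith
  have e: "e > 0"
    using c card_pos by (simp add: e_def)
  \<comment> \<open>The critical exponents are b + 1 for the height, 1 for the real part of the last
    coordinate, and 1/2 for every other coordinate, since the norm dominates the squares of those.
    They add up to n + 1 + b, and the 2n copies of e supply the rest of c.\<close>
  define s :: "complex^'n \<Rightarrow> real" where
    "s \<beta> = (if \<beta> = axis j0 \<i> then b + 1 + e else if \<beta> = axis j0 1 then 1 + e else 1/2 + e)" for \<beta>
  define k :: "complex^'n \<Rightarrow> real \<Rightarrow> real" where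
    "k \<beta> x = (if \<beta> = axis j0 \<i> then (1 + \<bar>x\<bar>) powr - (b + 1 + e)
      else if \<beta> = axis j0 1 then (1 + \<bar>x\<bar>) powr - (1 + e) else (1 + \<bar>x\<bar>) powr - (1 + 2 * e))" for \<beta> x
  \<comment> \<open>The factor \<open>Im (\<eta>$j0) powr b\<close> and the restriction to positive
    height are absorbed into the height coordinate.\<close>
  define g :: "complex^'n \<Rightarrow> real \<Rightarrow> real" where
    "g \<beta> x = (if \<beta> = axis j0 \<i> then indicator {0<..} x * (x powr b * (1 + x) powr - (b + 1 + e))
       else k \<beta> x)" for \<beta> x
  have [measurable]: "g \<beta> \<in> borel_measurable borel" for \<beta>
    unfolding g_def k_def by measurable
  have g_nonneg: "g \<beta> x \<ge> 0" for \<beta> x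
    by (auto simp: g_def k_def)
  have s_nonneg: "s \<beta> \<ge> 0" for \<beta>
    using b e by (auto simp: s_def)
  have "sum s Basis = (b + 1 + e) + (1 + e) + (\<Sum>\<beta>\<in>Basis - {axis j0 \<i>, axis j0 1 :: complex^'n}. 1/2 + e)"
    unfolding sum_Basis_split[of _ j0]
    by (intro arg_cong2[of _ _ _ _ "(+)"] sum.cong) (auto simp: s_def axis_complex_eq_iff)
  also have "\<dots> = (b + 1 + e) + (1 + e) + 2 * (real CARD('n) - 1) * (1/2 + e)"
    using card_Basis_complex_vec_rest[of j0] card_pos by (simp add: of_nat_diff)
  also have "\<dots> = c"
    using card_pos by (simp add: e_def field_simps)
  finally have sum_s: "sum s Basis = c" .
  have pointwise: "Im (\<eta>$j0) powr b / flat_norm j0 1 \<eta> powr c \<le> 16 powr c * (\<Prod>\<beta>\<in>Basis. g \<beta> (\<eta> \<bullet> \<beta>))"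
    if y: "0 < Im (\<eta>$j0)" for \<eta> :: "complex^'n"
  proof -
    \<comment> \<open>The factor 16 is large enough for N to dominate 1 + |x| in both coordinates at
      \<open>j0\<close> and (1 + |x|)^2 in each of the others.\<close>
    define N where "N = 16 * flat_norm j0 1 \<eta>"
    have S: "0 \<le> (\<Sum>j\<in>UNIV - {j0}. (cmod (\<eta>$j))\<^sup>2)"
      by (intro sum_nonneg) auto
    have N: "N \<ge> 8 + 8 * Im (\<eta>$j0) + 4 * (\<Sum>j\<in>UNIV - {j0}. (cmod (\<eta>$j))\<^sup>2)" "N \<ge> 8 * \<bar>Re (\<eta>$j0)\<bar>"
      using flat_norm_ge(1)[of 1 \<eta> j0] flat_norm_ge(2)[of \<eta> j0 1] by (auto simp: N_def)
    have "N powr - s \<beta> \<le> k \<beta> (\<eta> \<bullet> \<beta>)" if \<beta>: "\<beta> \<in> Basis" for \<beta>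
    proof (cases rule: Basis_complex_vec_cases[OF \<beta>, of j0])
      case 1
      then show ?thesis
        using N y S b e by (auto simp: s_def k_def inner_axis_ii intro!: powr_mono2')
    next
      case 2
      have "1 + \<bar>Re (\<eta>$j0)\<bar> \<le> N"
        using N S y by linarith
      with 2 show ?thesis
        using e by (auto simp: s_def k_def inner_axis_1 axis_complex_eq_iff intro!: powr_mono2')
    next
      case (3 j)
      then have \<beta>': "\<beta> \<noteq> axis j0 \<i>" "\<beta> \<noteq> axis j0 1"
        by (auto simp: axis_complex_eq_iff)
      define x where "x = \<eta> \<bullet> \<beta>"
      have "x\<^sup>2 \<le> (cmod (\<eta>$j))\<^sup>2"
        using 3 by (auto simp: x_def inner_axis_1 inner_axis_ii cmod_power2)
      also have "\<dots> \<le> (\<Sum>j\<in>UNIV - {j0}. (cmod (\<eta>$j))\<^sup>2)"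
        using 3 by (intro member_le_sum) auto
      finally have "8 + 4 * x\<^sup>2 \<le> N"
        using N y by linarith
      moreover have "(1 + \<bar>x\<bar>)\<^sup>2 \<le> 2 + 2 * x\<^sup>2"
        using zero_le_power2[of "1 - \<bar>x\<bar>"] by (simp add: power2_eq_square algebra_simps)
      ultimately have "(1 + \<bar>x\<bar>)\<^sup>2 \<le> N"
        using zero_le_power2[of x] by linarith
      then have "N powr - s \<beta> \<le> ((1 + \<bar>x\<bar>)\<^sup>2) powr - s \<beta>"
        using s_nonneg[of \<beta>] by (intro powr_mono2') (auto simp: zero_less_power)
      also have "\<dots> = ((1 + \<bar>x\<bar>) powr 2) powr - s \<beta>"
        by simp
      also have "\<dots> = k \<beta> x"
        using \<beta>' unfolding powr_powr by (simp add: k_def s_def)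
      finally show ?thesis
        by (simp add: x_def)
    qed
    then have "(\<Prod>\<beta>\<in>Basis. N powr - s \<beta>) \<le> (\<Prod>\<beta>\<in>Basis. k \<beta> (\<eta> \<bullet> \<beta>))"
      by (intro prod_mono) auto
    moreover have "N powr - c = (\<Prod>\<beta>\<in>Basis. N powr - s \<beta>)"
      unfolding sum_s[symmetric] sum_negf[symmetric] using N y S by (intro powr_sum) auto
    ultimately have "Im (\<eta>$j0) powr b * N powr - c \<le> Im (\<eta>$j0) powr b * (\<Prod>\<beta>\<in>Basis. k \<beta> (\<eta> \<bullet> \<beta>))"
      by (intro mult_left_mono) auto
    also have "\<dots> = (\<Prod>\<beta>\<in>Basis. g \<beta> (\<eta> \<bullet> \<beta>))"
    proof -
      have "(\<Prod>\<beta>\<in>Basis - {axis j0 \<i>, axis j0 1}. k \<beta> (\<eta> \<bullet> \<beta>)) = (\<Prod>\<beta>\<in>Basis - {axis j0 \<i>, axis j0 1}. g \<beta> (\<eta> \<bullet> \<beta>))"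
        by (intro prod.cong) (auto simp: g_def)
      then show ?thesis
        unfolding prod_Basis_split[of _ j0] using y
        by (simp add: g_def k_def inner_axis_ii axis_complex_eq_iff)
    qed
    finally have *: "Im (\<eta>$j0) powr b * N powr - c \<le> (\<Prod>\<beta>\<in>Basis. g \<beta> (\<eta> \<bullet> \<beta>))" .
    have pos: "flat_norm j0 1 \<eta> > 0"
      using flat_norm_gt_half[OF y, of 1] by linarith
    have "Im (\<eta>$j0) powr b / flat_norm j0 1 \<eta> powr c = 16 powr c * (Im (\<eta>$j0) powr b * N powr - c)"
      using pos unfolding N_def by (simp add: powr_mult powr_minus field_simps)
    also have "\<dots> \<le> 16 powr c * (\<Prod>\<beta>\<in>Basis. g \<beta> (\<eta> \<bullet> \<beta>))"
      using * by (intro mult_left_mono) auto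
    finally show ?thesis .
  qed
  have "flat_integral j0 b c 1 \<le> (\<integral>\<^sup>+\<eta>. ennreal (16 powr c) * (\<Prod>\<beta>\<in>Basis. ennreal (g \<beta> (\<eta> \<bullet> \<beta>))) \<partial>lborel)"
    unfolding flat_integral_def
  proof (intro nn_integral_mono)
    fix \<eta> :: "complex^'n"
    show "indicator {\<eta>. 0 < Im (\<eta>$j0)} \<eta> * ennreal (Im (\<eta>$j0) powr b / flat_norm j0 1 \<eta> powr c)
      \<le> ennreal (16 powr c) * (\<Prod>\<beta>\<in>Basis. ennreal (g \<beta> (\<eta> \<bullet> \<beta>)))"
      using pointwise[of \<eta>] g_nonneg
      by (auto simp: indicator_def prod_ennreal prod_nonneg simp flip: ennreal_mult intro!: ennreal_leI)
  qed
  also have "\<dots> = ennreal (16 powr c) * (\<Prod>\<beta>\<in>Basis. (\<integral>\<^sup>+x. ennreal (g \<beta> x) \<partial>lborel))"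
    using nn_integral_lborel_prod[of "\<lambda>\<beta> x. ennreal (g \<beta> x)"] by (simp add: nn_integral_cmult)
  also have "\<dots> < \<infinity>"
  proof -
    have "(\<integral>\<^sup>+x. ennreal (g \<beta> x) \<partial>lborel) < \<infinity>" for \<beta>
    proof -
      consider "\<beta> = axis j0 \<i>" | "\<beta> \<noteq> axis j0 \<i>" by blast
      then show ?thesis
      proof cases
        case 1
        then have "(\<lambda>x. ennreal (g \<beta> x)) = (\<lambda>x. indicator {0<..} x * ennreal (x powr b * (1 + x) powr - (b + 1 + e)))"
          by (auto simp: g_def indicator_def)
        then show ?thesis
          using nn_integral_powr_beta_finite[OF b e] by simp
      next
        case 2
        then show ?thesis
          using nn_integral_one_plus_abs_powr_finite[of "1 + e"]
            nn_integral_one_plus_abs_powr_finite[of "1 + 2 * e"] e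
          by (cases "\<beta> = axis j0 1") (auto simp: g_def k_def)
      qed
    qed
    then have "(\<Prod>\<beta>\<in>Basis. (\<integral>\<^sup>+x. ennreal (g \<beta> x) \<partial>lborel)) \<noteq> \<infinity>"
      by (simp add: ennreal_prod_eq_top less_top)
    then show ?thesis
      by (simp add: ennreal_mult_less_top less_top)
  qed
  finally show ?thesis .
qed

text \<open>On the unit cube \<open>flat_norm j0 1\<close> lies between two positive constants, so
  the integral there is at least a multiple of that of x^b over (0, 1].\<close>

lemma flat_integral_finite_imp_exponent_gt:
  fixes j0 :: "'n::finite"
  assumes "flat_integral j0 b c 1 < \<infinity>"
  shows "b > -1"
proof (rule ccontr)
  assume "\<not> b > -1"
  then have b: "b \<le> -1" by simp
  \<comment> \<open>On the cube the modulus in \<open>flat_norm\<close> is at most 2 + 2 + 2n from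
    the real part plus 2 from the imaginary part. Taking the larger of two powers in
    \<open>K\<close> covers both signs of c.\<close>
  define M where "M = (6 + 2 * real CARD('n)) / 4"
  define K where "K = max (M powr c) ((1/2) powr c)"
  have K: "K > 0"
    by (simp add: K_def less_max_iff_disj)
  define h :: "complex^'n \<Rightarrow> real \<Rightarrow> ennreal" where
    "h \<beta> x = (if \<beta> = axis j0 \<i> then ennreal (x powr b) * indicator {0<..1} x else indicator {0..1} x)" for \<beta> x
  have [measurable]: "h \<beta> \<in> borel_measurable borel" for \<beta>
    unfolding h_def by measurable
  have pointwise: "(\<Prod>\<beta>\<in>Basis. h \<beta> (\<eta> \<bullet> \<beta>)) \<le> ennreal K *
     (indicator {\<eta>. 0 < Im (\<eta>$j0)} \<eta> * ennreal (Im (\<eta>$j0) powr b / flat_norm j0 1 \<eta> powr c))" for \<eta>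
  proof (cases "\<exists>\<beta>\<in>Basis. h \<beta> (\<eta> \<bullet> \<beta>) = 0")
    case True
    then have "(\<Prod>\<beta>\<in>Basis. h \<beta> (\<eta> \<bullet> \<beta>)) = 0"
      by (intro prod_zero) auto
    then show ?thesis by (simp only: zero_le)
  next
    case False
    then have h: "h \<beta> (\<eta> \<bullet> \<beta>) \<noteq> 0" if "\<beta> \<in> Basis" for \<beta>
      using that by auto
    have y: "0 < Im (\<eta>$j0)" "Im (\<eta>$j0) \<le> 1"
      using h[of "axis j0 \<i>"] by (auto simp: Basis_complex_vec h_def inner_axis_ii indicator_def split: if_splits)
    have v: "0 \<le> Re (\<eta>$j)" "Re (\<eta>$j) \<le> 1" for j
      using h[of "axis j 1"] by (auto simp: Basis_complex_vec h_def inner_axis_1 axis_complex_eq_iff indicator_def split: if_splits)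
    have x: "0 \<le> Im (\<eta>$j)" "Im (\<eta>$j) \<le> 1" if "j \<noteq> j0" for j
      using h[of "axis j \<i>"] that by (auto simp: Basis_complex_vec h_def inner_axis_ii axis_complex_eq_iff indicator_def split: if_splits)
    have "(\<Sum>j\<in>UNIV - {j0}. (cmod (\<eta>$j))\<^sup>2) \<le> (\<Sum>j\<in>UNIV - {j0}. 2)"
    proof (intro sum_mono)
      fix j assume "j \<in> UNIV - {j0}"
      then have "(Re (\<eta>$j))\<^sup>2 \<le> 1" "(Im (\<eta>$j))\<^sup>2 \<le> 1"
        using v[of j] x[of j] by (auto simp: power_le_one)
      then show "(cmod (\<eta>$j))\<^sup>2 \<le> 2"
        by (simp add: cmod_power2)
    qed
    also have "\<dots> \<le> 2 * real CARD('n)"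
      by simp
    finally have S: "(\<Sum>j\<in>UNIV - {j0}. (cmod (\<eta>$j))\<^sup>2) \<le> 2 * real CARD('n)" .
    have S0: "0 \<le> (\<Sum>j\<in>UNIV - {j0}. (cmod (\<eta>$j))\<^sup>2)"
      by (intro sum_nonneg) auto
    have "flat_norm j0 1 \<eta> \<le> M"
      using cmod_le[of "Complex (2 * 1 + 2 * Im (\<eta>$j0) + (\<Sum>j\<in>UNIV - {j0}. (cmod (\<eta>$j))\<^sup>2)) (2 * Re (\<eta>$j0))"]
        S S0 y v[of j0] unfolding flat_norm_def M_def by simp
    moreover have half: "1/2 \<le> flat_norm j0 1 \<eta>"
      using flat_norm_gt_half[OF y(1), of 1] by simp
    ultimately have "flat_norm j0 1 \<eta> powr c \<le> K"
      using powr_mono2[of c "flat_norm j0 1 \<eta>" M] powr_mono2'[of c "1/2" "flat_norm j0 1 \<eta>"]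
      unfolding K_def by (cases "c \<ge> 0") auto
    from mult_right_mono[OF this, of "Im (\<eta>$j0) powr b"]
    have "Im (\<eta>$j0) powr b \<le> K * (Im (\<eta>$j0) powr b / flat_norm j0 1 \<eta> powr c)"
      using half by (simp add: field_simps)
    then have "ennreal (Im (\<eta>$j0) powr b) \<le> ennreal K * (indicator {\<eta>. 0 < Im (\<eta>$j0)} \<eta> * ennreal (Im (\<eta>$j0) powr b / flat_norm j0 1 \<eta> powr c))"
      using K y by (auto simp flip: ennreal_mult' intro!: ennreal_leI)
    moreover have "(\<Prod>\<beta>\<in>Basis. h \<beta> (\<eta> \<bullet> \<beta>)) = ennreal (Im (\<eta>$j0) powr b)"
    proof -
      have "(\<Prod>\<beta>\<in>Basis - {axis j0 \<i>, axis j0 1}. h \<beta> (\<eta> \<bullet> \<beta>)) = 1"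
      proof (intro prod.neutral ballI)
        fix \<beta> assume "\<beta> \<in> Basis - {axis j0 \<i>, axis j0 1 :: complex^'n}"
        then show "h \<beta> (\<eta> \<bullet> \<beta>) = 1"
          using h[of \<beta>] by (auto simp: h_def indicator_def split: if_splits)
      qed
      moreover have "h (axis j0 1) (\<eta> \<bullet> axis j0 1) = 1"
        using v[of j0] by (simp add: h_def inner_axis_1 axis_complex_eq_iff)
      ultimately show ?thesis
        unfolding prod_Basis_split[of _ j0] using y by (simp add: h_def inner_axis_ii)
    qed
    ultimately show ?thesis by simp
  qed
  have "(\<Prod>\<beta>\<in>Basis. \<integral>\<^sup>+x. h \<beta> x \<partial>lborel) = (\<integral>\<^sup>+\<eta>. (\<Prod>\<beta>\<in>Basis. h \<beta> (\<eta> \<bullet> \<beta>)) \<partial>lborel)"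
    by (simp add: nn_integral_lborel_prod)
  also have "\<dots> \<le> ennreal K * flat_integral j0 b c 1"
    unfolding flat_integral_def using pointwise
    by (subst nn_integral_cmult[symmetric]) (auto intro!: nn_integral_mono)
  also have "\<dots> < \<infinity>"
    using assms by (simp add: ennreal_mult_less_top)
  finally have "(\<Prod>\<beta>\<in>Basis. \<integral>\<^sup>+x. h \<beta> x \<partial>lborel) < \<infinity>" .
  moreover have "(\<Prod>\<beta>\<in>Basis. \<integral>\<^sup>+x. h \<beta> x \<partial>lborel) = \<infinity>"
  proof -
    have *: "(\<integral>\<^sup>+x. h \<beta> x \<partial>lborel) = 1" if "\<beta> \<noteq> axis j0 \<i>" for \<beta>
      using that by (simp add: h_def)
    have "(\<Prod>\<beta>\<in>Basis - {axis j0 \<i>, axis j0 1}. \<integral>\<^sup>+x. h \<beta> x \<partial>lborel) = 1"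
      by (intro prod.neutral) (auto simp: *)
    moreover have "(\<integral>\<^sup>+x. h (axis j0 \<i>) x \<partial>lborel) = \<infinity>"
      using nn_integral_powr_unit_infinite[OF b] by (simp add: h_def)
    moreover have "(\<integral>\<^sup>+x. h (axis j0 1) x \<partial>lborel) = 1"
      by (intro *) (simp add: axis_complex_eq_iff)
    ultimately show ?thesis
      unfolding prod_Basis_split[of _ j0] by simp
  qed
  ultimately show False by simp
qed

text \<open>Passing from r = 1 to r = 2 multiplies the integral by 2^(n+1+b-c). For c > 0 the
  integrand strictly decreases in r, so a finite positive integral forces this factor below 1, which
  is the claim.\<close>

lemma flat_integral_finite_imp_decay:
  fixes j0 :: "'n::finite"
  assumes fin: "flat_integral j0 b c 1 < \<infinity>"
  shows "c > real CARD('n) + 1 + b"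
proof -
  have b: "b > -1"
    by (rule flat_integral_finite_imp_exponent_gt[OF fin])
  have c_pos: "c > 0"
  proof (rule ccontr)
    assume "\<not> c > 0"
    then have c: "c \<le> 0" by simp
    \<comment> \<open>If c \<le> 0, finiteness is inherited by the exponent 0. That integral does
      not depend on r, while scaling multiplies it by 2^(n+1+b) > 1, which is absurd for a finite
      positive number.\<close>
    have "flat_integral j0 b 0 1 \<le> (\<integral>\<^sup>+\<eta>. ennreal ((1/2) powr c) *
       (indicator {\<eta>. 0 < Im (\<eta>$j0)} \<eta> * ennreal (Im (\<eta>$j0) powr b / flat_norm j0 1 \<eta> powr c)) \<partial>lborel)"
      unfolding flat_integral_def
    proof (intro nn_integral_mono)
      fix \<eta> :: "complex^'n"
      show "indicator {\<eta>. 0 < Im (\<eta>$j0)} \<eta> * ennreal (Im (\<eta>$j0) powr b / flat_norm j0 1 \<eta> powr 0)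
        \<le> ennreal ((1/2) powr c) * (indicator {\<eta>. 0 < Im (\<eta>$j0)} \<eta> * ennreal (Im (\<eta>$j0) powr b / flat_norm j0 1 \<eta> powr c))"
      proof (cases "0 < Im (\<eta>$j0)")
        case True
        have m: "1/2 < flat_norm j0 1 \<eta>"
          using flat_norm_gt_half[OF True, of 1] by simp
        then have "flat_norm j0 1 \<eta> powr c \<le> (1/2) powr c"
          using c by (intro powr_mono2') auto
        from mult_left_mono[OF this, of "Im (\<eta>$j0) powr b"]
        have "Im (\<eta>$j0) powr b / flat_norm j0 1 \<eta> powr 0 \<le> (1/2) powr c * (Im (\<eta>$j0) powr b / flat_norm j0 1 \<eta> powr c)"
          using m by (simp add: field_simps)
        then show ?thesis
          using True by (auto simp flip: ennreal_mult' intro!: ennreal_leI)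
      qed auto
    qed
    also have "\<dots> = ennreal ((1/2) powr c) * flat_integral j0 b c 1"
      unfolding flat_integral_def by (rule nn_integral_cmult) measurable
    also have "\<dots> < \<infinity>"
      using fin by (simp add: ennreal_mult_less_top)
    finally have fin0: "flat_integral j0 b 0 1 < \<infinity>" .
    \<comment> \<open>Since \<open>0 powr 0\<close> is 0, the equality of the integrands needs both
      norms to be nonzero, which the lower bound r/2 provides.\<close>
    have "flat_integral j0 b 0 2 = flat_integral j0 b 0 1"
      unfolding flat_integral_def
      by (intro nn_integral_cong) (use flat_norm_gt_half[of _ j0 1] flat_norm_gt_half[of _ j0 2] in
        \<open>fastforce simp: indicator_def\<close>)
    moreover have "flat_integral j0 b 0 2 = ennreal (2 powr (real CARD('n) + 1 + b)) * flat_integral j0 b 0 1"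
      using flat_integral_scale[of 2 j0 b 0 1] by simp
    ultimately have eq: "ennreal (2 powr (real CARD('n) + 1 + b)) * flat_integral j0 b 0 1 = flat_integral j0 b 0 1"
      by simp
    obtain I where I: "flat_integral j0 b 0 1 = ennreal I" "I > 0"
      using fin0 flat_integral_pos[of 1 j0 b 0] by (cases "flat_integral j0 b 0 1") auto
    then have "2 powr (real CARD('n) + 1 + b) = 1"
      using eq by (simp add: ennreal_mult[symmetric])
    then show False
      using b by simp
  qed
  have "flat_integral j0 b c 2 = ennreal (2 powr (real CARD('n) + 1 + b - c)) * flat_integral j0 b c 1"
    using flat_integral_scale[of 2 j0 b c 1] by simp
  \<comment> \<open>The strict pointwise inequality passes to the integrals because they are finite
    and the half-space, being open and nonempty, is not a null set.\<close>
  moreover have "flat_integral j0 b c 2 < flat_integral j0 b c 1"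
  proof -
    have less: "Im (\<eta>$j0) powr b / flat_norm j0 2 \<eta> powr c < Im (\<eta>$j0) powr b / flat_norm j0 1 \<eta> powr c"
      if "0 < Im (\<eta>$j0)" for \<eta> :: "complex^'n"
    proof -
      have m: "0 < flat_norm j0 1 \<eta>"
        using flat_norm_gt_half[OF that, of 1] by simp
      have S: "0 \<le> (\<Sum>j\<in>UNIV - {j0}. (cmod (\<eta>$j))\<^sup>2)"
        by (intro sum_nonneg) auto
      have "flat_norm j0 1 \<eta> < flat_norm j0 2 \<eta>"
        unfolding flat_norm_eq_sqrt using that S
        by (intro divide_strict_right_mono real_sqrt_less_mono add_strict_right_mono) (auto intro!: power_strict_mono)
      then show ?thesis
        using m c_pos that by (intro divide_strict_left_mono powr_less_mono2) auto
    qed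
    show ?thesis
      unfolding flat_integral_def
    proof (rule nn_integral_less)
      have "(\<integral>\<^sup>+\<eta>. indicator {\<eta>. 0 < Im (\<eta>$j0)} \<eta> * ennreal (Im (\<eta>$j0) powr b / flat_norm j0 2 \<eta> powr c) \<partial>lborel)
        \<le> flat_integral j0 b c 1"
        unfolding flat_integral_def using less
        by (intro nn_integral_mono) (auto simp: indicator_def less_imp_le intro!: ennreal_leI)
      then show "(\<integral>\<^sup>+\<eta>. indicator {\<eta>. 0 < Im (\<eta>$j0)} \<eta> * ennreal (Im (\<eta>$j0) powr b / flat_norm j0 2 \<eta> powr c) \<partial>lborel) \<noteq> \<infinity>"
        using fin by auto
      show "AE \<eta> in lborel. indicator {\<eta>. 0 < Im (\<eta>$j0)} \<eta> * ennreal (Im (\<eta>$j0) powr b / flat_norm j0 2 \<eta> powr c)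
         \<le> indicator {\<eta>. 0 < Im (\<eta>$j0)} \<eta> * ennreal (Im (\<eta>$j0) powr b / flat_norm j0 1 \<eta> powr c)"
        using less by (intro AE_I2) (auto simp: indicator_def less_imp_le intro!: ennreal_leI)
      show "\<not> (AE \<eta> in lborel. indicator {\<eta>. 0 < Im (\<eta>$j0)} \<eta> * ennreal (Im (\<eta>$j0) powr b / flat_norm j0 1 \<eta> powr c)
         \<le> indicator {\<eta>. 0 < Im (\<eta>$j0)} \<eta> * ennreal (Im (\<eta>$j0) powr b / flat_norm j0 2 \<eta> powr c))"
      proof
        assume "AE \<eta> in lborel. indicator {\<eta>. 0 < Im (\<eta>$j0)} \<eta> * ennreal (Im (\<eta>$j0) powr b / flat_norm j0 1 \<eta> powr c)
         \<le> indicator {\<eta>. 0 < Im (\<eta>$j0)} \<eta> * ennreal (Im (\<eta>$j0) powr b / flat_norm j0 2 \<eta> powr c)"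
        from AE_lborel_open_ex[OF this open_half_space[of j0] half_space_nonempty]
        obtain \<eta> :: "complex^'n" where "0 < Im (\<eta>$j0)"
          "ennreal (Im (\<eta>$j0) powr b / flat_norm j0 1 \<eta> powr c) \<le> ennreal (Im (\<eta>$j0) powr b / flat_norm j0 2 \<eta> powr c)"
          by (auto simp: indicator_def)
        then show False
          using less[of \<eta>] by (simp add: ennreal_le_iff)
      qed
    qed measurable
  qed
  ultimately have lt: "ennreal (2 powr (real CARD('n) + 1 + b - c)) * flat_integral j0 b c 1 < flat_integral j0 b c 1"
    by simp
  obtain I where I: "flat_integral j0 b c 1 = ennreal I" "I > 0"
    using fin flat_integral_pos[of 1 j0 b c] by (cases "flat_integral j0 b c 1") auto
  then have "2 powr (real CARD('n) + 1 + b - c) * I < I"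
    using lt by (simp add: ennreal_mult[symmetric] ennreal_less_iff)
  then have "2 powr (real CARD('n) + 1 + b - c) < 2 powr 0"
    using I(2) by simp
  then show ?thesis
    by (simp only: powr_less_cancel_iff)
qed

section \<open>Boundedness of the operators\<close>

lemma nonneg_exponent_if_powr_bounded_near_0:
  fixes p D :: real
  assumes "\<And>t. 0 < t \<Longrightarrow> t \<le> 1 \<Longrightarrow> t powr p \<le> D"
  shows "p \<ge> 0"
proof (rule ccontr)
  assume "\<not> p \<ge> 0"
  then have p: "p < 0" by simp
  \<comment> \<open>This solves t^p = |D| + 2, a value above D; since the base exceeds 1 and p < 0,
    it lies in (0, 1].\<close>
  define t where "t = (\<bar>D\<bar> + 2) powr (1 / p)"
  have "(\<bar>D\<bar> + 2) powr (1 / p) \<le> (\<bar>D\<bar> + 2) powr 0"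
    using p by (intro powr_mono) auto
  then have "0 < t" "t \<le> 1"
    by (auto simp: t_def split: if_splits)
  moreover have "t powr p = \<bar>D\<bar> + 2"
    using p by (simp add: t_def powr_powr)
  ultimately show False
    using assms[of t] by linarith
qed

lemma zero_exponent_if_powr_bounded:
  fixes p D :: real
  assumes "\<And>t. 0 < t \<Longrightarrow> t powr p \<le> D"
  shows "p = 0"
proof -
  have "p \<ge> 0"
    using assms by (rule nonneg_exponent_if_powr_bounded_near_0)
  moreover have "- p \<ge> 0"
  proof (rule nonneg_exponent_if_powr_bounded_near_0)
    fix t :: real assume "0 < t"
    then show "t powr - p \<le> D"
      using assms[of "1 / t"] by (simp add: powr_divide powr_minus inverse_eq_divide)
  qed
  ultimately show ?thesis by simp
qed

lemma fst_borel_measurable [measurable (raw)]: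
  fixes f :: "'a \<Rightarrow> 'b::euclidean_space \<times> 'c::euclidean_space"
  shows "f \<in> borel_measurable M \<Longrightarrow> (\<lambda>x. fst (f x)) \<in> borel_measurable M"
  by (rule measurable_compose, assumption) (intro borel_measurable_continuous_onI continuous_intros)

lemma snd_borel_measurable [measurable (raw)]:
  fixes f :: "'a \<Rightarrow> 'b::euclidean_space \<times> 'c::euclidean_space"
  shows "f \<in> borel_measurable M \<Longrightarrow> (\<lambda>x. snd (f x)) \<in> borel_measurable M"
  by (rule measurable_compose, assumption) (intro borel_measurable_continuous_onI continuous_intros)

lemma kernel_integral_eq:
  fixes w :: "complex^'n::finite"
  assumes "w \<in> TB j0"
  shows "kernel_integral j0 b c w =
    ennreal (rho j0 w powr (real CARD('n) + 1 + b - c)) * flat_integral j0 b c 1"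
  using flat_integral_scale[of "rho j0 w" j0 b c 1] assms
  by (simp add: kernel_integral_eq_flat mem_TB_iff)

lemma dVa_nn_integral:
  assumes [measurable]: "f \<in> borel_measurable borel"
  shows "(\<integral>\<^sup>+z. f z \<partial>dVa j0 \<alpha>) = (\<integral>\<^sup>+z. indicator (TB j0) z * ennreal (rho j0 z powr \<alpha>) * f z \<partial>lborel)"
  unfolding dVa_def by (rule nn_integral_density) measurable

text \<open>The density is strictly positive on the domain, so the weight does not change the null
  sets there.\<close>

lemma AE_dVa_iff: "(AE z in dVa j0 \<alpha>. P z) \<longleftrightarrow> (AE z in lborel. z \<in> TB j0 \<longrightarrow> P z)"
  unfolding dVa_def
  by (subst AE_density) (auto simp: indicator_def mem_TB_iff powr_eq_0_iff zero_less_mult_iff intro!: AE_cong)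

lemma AE_dVV_iff: "(AE x in dVV j0. P x) \<longleftrightarrow> (AE x in lborel. x \<in> TB j0 \<times> TB j0 \<longrightarrow> P x)"
  unfolding dVV_def lborel_prod
  by (subst AE_density) (auto simp: indicator_def intro!: borel_measurable_indicator borel_open open_Times open_TB)

lemma sets_dVa [measurable_cong]: "sets (dVa j0 \<alpha>) = sets borel"
  by (simp add: dVa_def)

lemma sets_dVV [measurable_cong]: "sets (dVV j0) = sets borel"
  by (simp add: dVV_def lborel_prod)

section \<open>Operators whose kernel has the common modulus\<close>

text \<open>The kernel is used only through these three properties. Continuity is required in the
  output point alone: it is what allows an almost everywhere bound on the image to be read off at a
  chosen point.\<close>

locale TB_kernel =
  fixes j0 :: "'n::finite" and b1 b2 c1 c2 :: real
    and K :: "complex^'n \<Rightarrow> complex^'n \<Rightarrow> complex^'n \<Rightarrow> complex^'n \<Rightarrow> complex"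
  assumes K_measurable_pair:
      "(\<lambda>(x, y). K (fst x) (snd x) (fst y) (snd y)) \<in> borel_measurable (borel \<Otimes>\<^sub>M borel)"
    and norm_K: "\<And>z w u \<eta>. \<lbrakk>z \<in> TB j0; w \<in> TB j0; u \<in> TB j0; \<eta> \<in> TB j0\<rbrakk> \<Longrightarrow>
      cmod (K z w u \<eta>) = (rho j0 u powr b1 / cmod (rho2 j0 z u) powr c1) *
        (rho j0 \<eta> powr b2 / cmod (rho2 j0 w \<eta>) powr c2)"
    and K_continuous: "\<And>u \<eta>. \<lbrakk>u \<in> TB j0; \<eta> \<in> TB j0\<rbrakk> \<Longrightarrow>
      continuous_on (TB j0 \<times> TB j0) (\<lambda>x. K (fst x) (snd x) u \<eta>)"
begin

lemma K_measurable [measurable (raw)]: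
  assumes [measurable]: "f \<in> borel_measurable M" "g \<in> borel_measurable M"
     "h \<in> borel_measurable M" "k \<in> borel_measurable M"
  shows "(\<lambda>x. K (f x) (g x) (h x) (k x)) \<in> borel_measurable M"
proof -
  have "(\<lambda>x. ((f x, g x), (h x, k x))) \<in> measurable M (borel \<Otimes>\<^sub>M borel)"
    by measurable
  from measurable_compose[OF this K_measurable_pair] show ?thesis
    by simp
qed

lemma op_integrand_measurable [measurable]:
  assumes [measurable]: "f \<in> borel_measurable borel"
  shows "op_integrand K j0 f x \<in> borel_measurable borel"
  unfolding op_integrand_def[abs_def] indicator_times by measurable

lemma op_apply_measurable [measurable]:
  assumes [measurable]: "f \<in> borel_measurable borel"
  shows "op_apply a1 a2 K j0 f \<in> borel_measurable borel"
proof -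
  have "(\<lambda>(x, y). op_integrand K j0 f x y) \<in> borel_measurable (borel \<Otimes>\<^sub>M lborel)"
    unfolding op_integrand_def[abs_def] indicator_times by measurable
  then have "(\<lambda>x. \<integral>y. op_integrand K j0 f x y \<partial>lborel) \<in> borel_measurable borel"
    by (rule lborel.borel_measurable_lebesgue_integral)
  then show ?thesis
    unfolding op_apply_def[abs_def] lborel_prod by measurable
qed

text \<open>The modulus of \<open>rho2 j0 z u\<close> is at least half of either height. Splitting
  its exponent as a1 + (b1 - \<alpha>1) into nonnegative parts, one part absorbs the power of
  \<open>rho j0 z\<close> and the other the surplus power of \<open>rho j0 u\<close>; the halves
  produce 2^c1.\<close>

lemma weighted_kernel_le:
  assumes "z \<in> TB j0" "u \<in> TB j0" "a1 \<ge> 0" "b1 \<ge> \<alpha>1" "c1 = a1 + b1 - \<alpha>1"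
  shows "rho j0 z powr a1 * (rho j0 u powr b1 / cmod (rho2 j0 z u) powr c1) \<le> 2 powr c1 * rho j0 u powr \<alpha>1"
proof -
  define m where "m = cmod (rho2 j0 z u)"
  have pos: "rho j0 z > 0" "rho j0 u > 0"
    using assms by (auto simp: mem_TB_iff)
  have m: "rho j0 z / 2 \<le> m" "rho j0 u / 2 \<le> m"
    using norm_rho2_ge[of j0 z u] pos by (auto simp: m_def)
  then have m_pos: "m > 0" using pos by linarith
  have "(rho j0 z / 2) powr a1 * (rho j0 u / 2) powr (b1 - \<alpha>1) \<le> m powr a1 * m powr (b1 - \<alpha>1)"
    using m pos assms by (intro mult_mono powr_mono2) auto
  also have "\<dots> = m powr c1"
    using assms(5) by (simp add: powr_add[symmetric] add_diff_eq)
  finally have *: "(rho j0 z / 2) powr a1 * (rho j0 u / 2) powr (b1 - \<alpha>1) \<le> m powr c1" .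
  have "rho j0 z powr a1 * rho j0 u powr (b1 - \<alpha>1) \<le> 2 powr c1 * m powr c1"
  proof -
    have "2 powr c1 = 2 powr a1 * 2 powr (b1 - \<alpha>1)"
      unfolding assms(5) powr_add[symmetric] by (simp add: add_diff_eq)
    then have "(rho j0 z / 2) powr a1 * (rho j0 u / 2) powr (b1 - \<alpha>1) =
        rho j0 z powr a1 * rho j0 u powr (b1 - \<alpha>1) / 2 powr c1"
      using pos by (simp add: powr_divide)
    then show ?thesis
      using * by (simp add: divide_le_eq mult.commute)
  qed
  from mult_right_mono[OF this, of "rho j0 u powr \<alpha>1"]
  have "rho j0 z powr a1 * rho j0 u powr b1 \<le> 2 powr c1 * m powr c1 * rho j0 u powr \<alpha>1"
    by (simp add: mult.assoc powr_add[symmetric])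
  then show ?thesis
    unfolding m_def[symmetric] using m_pos by (simp add: field_simps)
qed

text \<open>With the u-integral innermost, the first factor is removed by
  \<open>weighted_kernel_le\<close>, and what remains is the inner norm of f, at most the mixed norm
  for almost every \<eta>. The second factor then integrates to a multiple of
  \<open>rho j0 w powr - a2\<close>, cancelled by the outer weight.\<close>

lemma bounded_if_exponents:
  assumes a: "a1 \<ge> 0" "a2 > 0" and b: "b1 \<ge> \<alpha>1" "b2 > -1"
    and c: "c1 = a1 + b1 - \<alpha>1" "c2 = real CARD('n) + 1 + a2 + b2"
  shows "bounded_1inf_to_inf a1 a2 K j0 \<alpha>1 \<alpha>2"
proof -
  define I where "I = enn2real (flat_integral j0 b2 c2 1)"
  have "flat_integral j0 b2 c2 1 < \<infinity>"
    using a b c by (intro flat_integral_finite) auto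
  then have I: "flat_integral j0 b2 c2 1 = ennreal I"
    by (simp add: I_def less_top)
  have I_nonneg: "I \<ge> 0"
    by (simp add: I_def)
  have kint: "kernel_integral j0 b2 c2 w = ennreal (rho j0 w powr - a2 * I)" if "w \<in> TB j0" for w
    using kernel_integral_eq[OF that, of b2 c2] c(2) I_nonneg unfolding I by (simp add: ennreal_mult)
  define C where "C = 2 powr c1 * I"
  \<comment> \<open>The bound is proved for the integral of the modulus and at every point of the
    domain, so that it yields both absolute convergence and the norm estimate.\<close>
  have main: "ennreal (rho j0 z powr a1 * rho j0 w powr a2) *
      (\<integral>\<^sup>+y. ennreal (norm (op_integrand K j0 f (z, w) y)) \<partial>lborel) \<le> ennreal C * mixnorm_1inf j0 \<alpha>1 \<alpha>2 f"
    if f [measurable]: "f \<in> borel_measurable borel" and z: "z \<in> TB j0" and w: "w \<in> TB j0" for f z w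
  proof -
    define M where "M = mixnorm_1inf j0 \<alpha>1 \<alpha>2 f"
    define A where "A \<eta> = (\<integral>\<^sup>+u. ennreal (norm (f (u, \<eta>))) \<partial>dVa j0 \<alpha>1)" for \<eta>
    define k2 where "k2 \<eta> = rho j0 \<eta> powr b2 / cmod (rho2 j0 w \<eta>) powr c2" for \<eta>
    have [measurable]: "k2 \<in> borel_measurable borel"
      unfolding k2_def by measurable
    have AE_A: "AE \<eta> in lborel. \<eta> \<in> TB j0 \<longrightarrow> A \<eta> \<le> M"
      using esssup_AE[of A "dVa j0 \<alpha>2"] unfolding AE_dVa_iff M_def mixnorm_1inf_def A_def .
    have "ennreal (rho j0 z powr a1) * (\<integral>\<^sup>+y. ennreal (norm (op_integrand K j0 f (z, w) y)) \<partial>lborel)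
      = ennreal (rho j0 z powr a1) * (\<integral>\<^sup>+\<eta>. \<integral>\<^sup>+u. ennreal (norm (op_integrand K j0 f (z, w) (u, \<eta>))) \<partial>lborel \<partial>lborel)"
      by (subst lborel_pair.nn_integral_snd) (auto simp: lborel_prod borel_prod)
    also have "\<dots> = (\<integral>\<^sup>+\<eta>. ennreal (rho j0 z powr a1) * (\<integral>\<^sup>+u. ennreal (norm (op_integrand K j0 f (z, w) (u, \<eta>))) \<partial>lborel) \<partial>lborel)"
      by (subst nn_integral_cmult) (auto intro!: lborel.borel_measurable_nn_integral)
    also have "\<dots> \<le> (\<integral>\<^sup>+\<eta>. ennreal (2 powr c1) * M * (indicator (TB j0) \<eta> * ennreal (k2 \<eta>)) \<partial>lborel)"
    proof (rule nn_integral_mono_AE)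
      show "AE \<eta> in lborel. ennreal (rho j0 z powr a1) * (\<integral>\<^sup>+u. ennreal (norm (op_integrand K j0 f (z, w) (u, \<eta>))) \<partial>lborel)
        \<le> ennreal (2 powr c1) * M * (indicator (TB j0) \<eta> * ennreal (k2 \<eta>))"
        using AE_A
      proof eventually_elim
        fix \<eta> assume A: "\<eta> \<in> TB j0 \<longrightarrow> A \<eta> \<le> M"
        show "ennreal (rho j0 z powr a1) * (\<integral>\<^sup>+u. ennreal (norm (op_integrand K j0 f (z, w) (u, \<eta>))) \<partial>lborel)
          \<le> ennreal (2 powr c1) * M * (indicator (TB j0) \<eta> * ennreal (k2 \<eta>))"
        proof (cases "\<eta> \<in> TB j0")
          case False
          then show ?thesis by (simp add: op_integrand_def)
        next
          case True
          have "ennreal (rho j0 z powr a1) * (\<integral>\<^sup>+u. ennreal (norm (op_integrand K j0 f (z, w) (u, \<eta>))) \<partial>lborel)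
            = (\<integral>\<^sup>+u. ennreal (rho j0 z powr a1 * norm (op_integrand K j0 f (z, w) (u, \<eta>))) \<partial>lborel)"
            by (simp add: ennreal_mult nn_integral_cmult)
          also have "\<dots> \<le> (\<integral>\<^sup>+u. ennreal (2 powr c1 * k2 \<eta>) *
              (indicator (TB j0) u * ennreal (rho j0 u powr \<alpha>1) * ennreal (norm (f (u, \<eta>)))) \<partial>lborel)"
          proof (intro nn_integral_mono)
            fix u
            show "ennreal (rho j0 z powr a1 * norm (op_integrand K j0 f (z, w) (u, \<eta>))) \<le> ennreal (2 powr c1 * k2 \<eta>) *
              (indicator (TB j0) u * ennreal (rho j0 u powr \<alpha>1) * ennreal (norm (f (u, \<eta>))))"
            proof (cases "u \<in> TB j0")
              case False
              then show ?thesis by (simp add: op_integrand_def)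
            next
              case u: True
              have "rho j0 z powr a1 * norm (op_integrand K j0 f (z, w) (u, \<eta>)) =
                rho j0 z powr a1 * (rho j0 u powr b1 / cmod (rho2 j0 z u) powr c1) * (k2 \<eta> * norm (f (u, \<eta>)))"
                using u True z w by (simp add: op_integrand_def norm_mult norm_K k2_def)
              also have "\<dots> \<le> 2 powr c1 * rho j0 u powr \<alpha>1 * (k2 \<eta> * norm (f (u, \<eta>)))"
                using weighted_kernel_le[OF z u a(1) b(1) c(1)]
                by (intro mult_right_mono) (auto simp: k2_def)
              finally show ?thesis
                using u by (auto simp: k2_def mult_ac simp flip: ennreal_mult intro!: ennreal_leI)
            qed
          qed
          also have "\<dots> = ennreal (2 powr c1 * k2 \<eta>) * A \<eta>"
            unfolding A_def by (subst nn_integral_cmult, measurable) (subst dVa_nn_integral, auto)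
          also have "\<dots> \<le> ennreal (2 powr c1 * k2 \<eta>) * M"
            using A True by (intro mult_left_mono) auto
          also have "ennreal (2 powr c1 * k2 \<eta>) = ennreal (2 powr c1) * ennreal (k2 \<eta>)"
            by (rule ennreal_mult) (auto simp: k2_def)
          finally show ?thesis
            using True by (simp add: mult_ac)
        qed
      qed
    qed
    also have "\<dots> = ennreal (2 powr c1) * M * kernel_integral j0 b2 c2 w"
      unfolding kernel_integral_def k2_def[symmetric] by (rule nn_integral_cmult) measurable
    also have "\<dots> = ennreal (2 powr c1) * M * ennreal (rho j0 w powr - a2 * I)"
      by (simp add: kint[OF w])
    finally have "ennreal (rho j0 w powr a2) * (ennreal (rho j0 z powr a1) * (\<integral>\<^sup>+y. ennreal (norm (op_integrand K j0 f (z, w) y)) \<partial>lborel))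
      \<le> ennreal (rho j0 w powr a2) * (ennreal (2 powr c1) * M * ennreal (rho j0 w powr - a2 * I))"
      by (rule mult_left_mono) simp
    also have "\<dots> = ennreal (rho j0 w powr a2 * (2 powr c1 * (rho j0 w powr - a2 * I))) * M"
      by (simp add: ennreal_mult I_nonneg mult_ac)
    also have "rho j0 w powr a2 * (2 powr c1 * (rho j0 w powr - a2 * I)) = C"
      using w by (simp add: C_def mem_TB_iff powr_minus field_simps)
    finally show ?thesis
      by (simp add: ennreal_mult M_def mult_ac)
  qed
  show ?thesis
    unfolding bounded_1inf_to_inf_def lborel_prod
  proof (intro exI[of _ C] conjI allI impI; (elim conjE)?)
    show "C \<ge> 0"
      by (simp add: C_def I_nonneg)
    fix f assume "f \<in> borel_measurable (lborel :: ((complex^'n) \<times> (complex^'n)) measure)"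
      and fin: "mixnorm_1inf j0 \<alpha>1 \<alpha>2 f < \<infinity>"
    then have [measurable]: "f \<in> borel_measurable borel" by simp
    have int: "integrable lborel (op_integrand K j0 f (z, w))" if z: "z \<in> TB j0" and w: "w \<in> TB j0" for z w
    proof (rule integrableI_bounded)
      have "ennreal (rho j0 z powr a1 * rho j0 w powr a2) *
        (\<integral>\<^sup>+y. ennreal (norm (op_integrand K j0 f (z, w) y)) \<partial>lborel) < \<infinity>"
        using fin by (intro le_less_trans[OF main]) (auto simp: ennreal_mult_less_top z w)
      moreover have "rho j0 z powr a1 * rho j0 w powr a2 > 0"
        using z w by (simp add: mem_TB_iff)
      ultimately show "(\<integral>\<^sup>+y. ennreal (norm (op_integrand K j0 f (z, w) y)) \<partial>lborel) < \<infinity>"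
        by (auto simp: ennreal_mult_less_top ennreal_eq_0_iff)
    qed measurable
    then show "AE x in dVV j0. integrable lborel (op_integrand K j0 f x)"
      unfolding AE_dVV_iff by auto
    show "Linf_norm j0 (op_apply a1 a2 K j0 f) \<le> ennreal C * mixnorm_1inf j0 \<alpha>1 \<alpha>2 f"
      unfolding Linf_norm_def
    proof (rule esssup_I)
      show "AE x in dVV j0. ennreal (norm (op_apply a1 a2 K j0 f x)) \<le> ennreal C * mixnorm_1inf j0 \<alpha>1 \<alpha>2 f"
        unfolding AE_dVV_iff
      proof (intro AE_I2 impI)
        fix x assume "x \<in> TB j0 \<times> TB j0"
        then obtain z w where x: "x = (z, w)" "z \<in> TB j0" "w \<in> TB j0" by auto
        have "ennreal (norm (op_apply a1 a2 K j0 f x)) =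
          ennreal (rho j0 z powr a1 * rho j0 w powr a2) * ennreal (norm (\<integral>y. op_integrand K j0 f (z, w) y \<partial>lborel))"
          by (simp add: op_apply_def x norm_mult lborel_prod ennreal_mult)
        also have "\<dots> \<le> ennreal (rho j0 z powr a1 * rho j0 w powr a2) *
            (\<integral>\<^sup>+y. ennreal (norm (op_integrand K j0 f (z, w) y)) \<partial>lborel)"
          using integral_norm_bound_ennreal[OF int[OF x(2,3)]] by (intro mult_left_mono) auto
        also have "\<dots> \<le> ennreal C * mixnorm_1inf j0 \<alpha>1 \<alpha>2 f"
          by (rule main) (use x in auto)
        finally show "ennreal (norm (op_apply a1 a2 K j0 f x)) \<le> ennreal C * mixnorm_1inf j0 \<alpha>1 \<alpha>2 f" .
      qed
    qed measurable
  qed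
qed

section \<open>Necessity of the conditions on the exponents\<close>

text \<open>It supplies the constant majorant for dominated convergence. The argument goes through
  the explicit modulus, which is jointly continuous in all variables, whereas the kernel itself is
  assumed continuous only in the output point.\<close>

lemma abs_kernel_bounded_on_compact:
  assumes "compact A" "A \<subseteq> TB j0 \<times> TB j0" "compact Y" "Y \<subseteq> TB j0 \<times> TB j0"
  obtains D where "\<And>x y. x \<in> A \<Longrightarrow> y \<in> Y \<Longrightarrow> cmod (K (fst x) (snd x) (fst y) (snd y)) \<le> D"
proof -
  define h where "h p = (rho j0 (fst (snd p)) powr b1 / cmod (rho2 j0 (fst (fst p)) (fst (snd p))) powr c1) *
        (rho j0 (snd (snd p)) powr b2 / cmod (rho2 j0 (snd (fst p)) (snd (snd p))) powr c2)"
    for p :: "((complex^'n) \<times> (complex^'n)) \<times> (complex^'n) \<times> (complex^'n)"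
  have nz: "rho2 j0 z u \<noteq> 0" if "z \<in> TB j0" "u \<in> TB j0" for z u
    using norm_rho2_ge[of j0 z u] that by (auto simp: mem_TB_iff)
  have "continuous_on (A \<times> Y) h"
    unfolding h_def using assms(2,4)
    by (intro continuous_intros) (fastforce simp: mem_TB_iff dest: nz)+
  then have "bounded (h ` (A \<times> Y))"
    using assms by (intro compact_imp_bounded compact_continuous_image compact_Times)
  then obtain D where D: "\<And>p. p \<in> A \<times> Y \<Longrightarrow> norm (h p) \<le> D"
    unfolding bounded_iff by auto
  show ?thesis
  proof (rule that)
    fix x y assume xy: "x \<in> A" "y \<in> Y"
    then have "fst x \<in> TB j0" "snd x \<in> TB j0" "fst y \<in> TB j0" "snd y \<in> TB j0"
      using assms(2,4) by auto
    then have "cmod (K (fst x) (snd x) (fst y) (snd y)) = h (x, y)"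
      by (simp add: norm_K h_def)
    also have "\<dots> \<le> D"
      using D[of "(x, y)"] xy by auto
    finally show "cmod (K (fst x) (snd x) (fst y) (snd y)) \<le> D" .
  qed
qed

text \<open>Testing on \<^term>\<open>indicator (B \<times> E)\<close> multiplied by the conjugate phase of the kernel at
  a fixed point \<^term>\<open>(z, w)\<close>. Compactness makes the image function continuous, so that the
  almost everywhere bound holds at \<^term>\<open>(z, w)\<close>, where the integrand is the modulus of the kernel.\<close>

lemma compact_test_estimate:
  assumes C: "C \<ge> 0"
    and bnd: "\<And>f. f \<in> borel_measurable borel \<Longrightarrow> mixnorm_1inf j0 \<alpha>1 \<alpha>2 f < \<infinity> \<Longrightarrow>
      Linf_norm j0 (op_apply a1 a2 K j0 f) \<le> ennreal C * mixnorm_1inf j0 \<alpha>1 \<alpha>2 f"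
    and z: "z \<in> TB j0" and w: "w \<in> TB j0"
    and B: "compact B" "B \<subseteq> TB j0" and E: "compact E" "E \<subseteq> TB j0"
  shows "ennreal (rho j0 z powr a1 * rho j0 w powr a2) *
      ((\<integral>\<^sup>+u. indicator B u * ennreal (rho j0 u powr b1 / cmod (rho2 j0 z u) powr c1) \<partial>lborel) *
       (\<integral>\<^sup>+\<eta>. indicator E \<eta> * ennreal (rho j0 \<eta> powr b2 / cmod (rho2 j0 w \<eta>) powr c2) \<partial>lborel))
    \<le> ennreal C * (\<integral>\<^sup>+u. indicator B u * ennreal (rho j0 u powr \<alpha>1) \<partial>lborel)"
proof -
  define Y where "Y = B \<times> E"
  have Y: "compact Y" "Y \<subseteq> TB j0 \<times> TB j0"
    using B E by (auto simp: Y_def compact_Times)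
  have [measurable]: "B \<in> sets borel" "E \<in> sets borel"
    using B E by (auto intro: borel_compact)
  have Y_meas [measurable]: "Y \<in> sets borel"
    using Y by (auto intro: borel_compact)
  define V where "V = (\<integral>\<^sup>+u. indicator B u * ennreal (rho j0 u powr \<alpha>1) \<partial>lborel)"
  have "integrable lborel (\<lambda>u. indicator B u *\<^sub>R (rho j0 u powr \<alpha>1))"
    using B by (intro borel_integrable_compact continuous_intros) (fastforce simp: mem_TB_iff)+
  then have "(\<integral>\<^sup>+u. ennreal (norm (indicator B u *\<^sub>R (rho j0 u powr \<alpha>1))) \<partial>lborel) < \<infinity>"
    by (simp add: integrable_iff_bounded)
  also have "(\<integral>\<^sup>+u. ennreal (norm (indicator B u *\<^sub>R (rho j0 u powr \<alpha>1))) \<partial>lborel) = V"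
    unfolding V_def by (intro nn_integral_cong) (auto simp: indicator_def)
  finally have V_fin: "V < \<infinity>" .
  define f where "f y = indicator Y y * cnj (sgn (K z w (fst y) (snd y)))" for y
  have cnj_meas [measurable]: "cnj \<in> borel_measurable borel"
    by (intro borel_measurable_continuous_onI continuous_intros)
  have f_meas [measurable]: "f \<in> borel_measurable borel"
    unfolding f_def Y_def indicator_times by measurable
  have norm_f: "norm (f (u, \<eta>)) \<le> indicator B u" for u \<eta>
    by (auto simp: f_def Y_def indicator_def norm_mult norm_sgn)
  \<comment> \<open>The outer norm is an essential supremum, so the set \<open>E\<close> does not
    enter the bound.\<close>
  have mix: "mixnorm_1inf j0 \<alpha>1 \<alpha>2 f \<le> V"
    unfolding mixnorm_1inf_def
  proof (rule esssup_I)
    show "AE \<eta> in dVa j0 \<alpha>2. (\<integral>\<^sup>+u. ennreal (norm (f (u, \<eta>))) \<partial>dVa j0 \<alpha>1) \<le> V"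
    proof (intro AE_I2)
      fix \<eta>
      have "(\<integral>\<^sup>+u. ennreal (norm (f (u, \<eta>))) \<partial>dVa j0 \<alpha>1) \<le> (\<integral>\<^sup>+u. indicator B u \<partial>dVa j0 \<alpha>1)"
        using norm_f[of _ \<eta>] by (intro nn_integral_mono) (auto simp flip: ennreal_indicator intro!: ennreal_leI)
      also have "\<dots> = V"
        unfolding V_def using B by (subst dVa_nn_integral) (auto intro!: nn_integral_cong simp: indicator_def)
      finally show "(\<integral>\<^sup>+u. ennreal (norm (f (u, \<eta>))) \<partial>dVa j0 \<alpha>1) \<le> V" .
    qed
    show "(\<lambda>\<eta>. \<integral>\<^sup>+u. ennreal (norm (f (u, \<eta>))) \<partial>dVa j0 \<alpha>1) \<in> borel_measurable (dVa j0 \<alpha>2)"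
      by (subst dVa_nn_integral, measurable)
  qed
  then have "Linf_norm j0 (op_apply a1 a2 K j0 f) \<le> ennreal C * mixnorm_1inf j0 \<alpha>1 \<alpha>2 f"
    using V_fin by (intro bnd) auto
  also have "\<dots> \<le> ennreal C * V"
    using mix by (rule mult_left_mono) simp
  finally have "AE x in dVV j0. ennreal (norm (op_apply a1 a2 K j0 f x)) \<le> ennreal C * V"
    using esssup_AE[of "\<lambda>x. ennreal (norm (op_apply a1 a2 K j0 f x))" "dVV j0"] unfolding Linf_norm_def
    by (auto elim: eventually_mono intro: order_trans)
  then have AE_bnd: "AE x in lborel. x \<in> TB j0 \<times> TB j0 \<longrightarrow> ennreal (norm (op_apply a1 a2 K j0 f x)) \<le> ennreal C * V"
    unfolding AE_dVV_iff .
  have TB2: "open (TB j0 \<times> TB j0)" "(z, w) \<in> TB j0 \<times> TB j0"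
    using z w open_TB by (auto intro: open_Times)
  then obtain d where d: "d > 0" "cball (z, w) d \<subseteq> TB j0 \<times> TB j0"
    using open_contains_cball by blast
  \<comment> \<open>Points at which the bound holds are found in shrinking balls about
    \<open>(z, w)\<close>; all of them stay in a compact ball inside the domain, where the kernel is
    uniformly bounded against \<open>Y\<close>.\<close>
  have "\<exists>x. x \<in> ball (z, w) (d / real (Suc k)) \<and> ennreal (norm (op_apply a1 a2 K j0 f x)) \<le> ennreal C * V" for k
  proof -
    have "\<exists>x\<in>ball (z, w) (d / real (Suc k)). x \<in> TB j0 \<times> TB j0 \<longrightarrow> ennreal (norm (op_apply a1 a2 K j0 f x)) \<le> ennreal C * V"
    proof (rule AE_lborel_open_ex[OF AE_bnd open_ball])
      have "d / real (Suc k) > 0"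
        using d by simp
      then have "(z, w) \<in> ball (z, w) (d / real (Suc k))"
        by (simp only: centre_in_ball)
      then show "ball (z, w) (d / real (Suc k)) \<noteq> {}"
        by blast
    qed
    moreover have "ball (z, w) (d / real (Suc k)) \<subseteq> TB j0 \<times> TB j0"
    proof -
      have "d / real (Suc k) \<le> d"
        using d by (simp add: field_simps)
      then show ?thesis
        using d ball_subset_cball[of "(z, w)" d] subset_ball[of "d / real (Suc k)" d "(z, w)"] by blast
    qed
    ultimately show ?thesis by blast
  qed
  then obtain X where X: "\<And>k. X k \<in> ball (z, w) (d / real (Suc k))"
      "\<And>k. ennreal (norm (op_apply a1 a2 K j0 f (X k))) \<le> ennreal C * V"
    by metis
  have X_cball: "X k \<in> cball (z, w) d" for k
  proof -
    have "d / real (Suc k) \<le> d"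
      using d by (simp add: field_simps)
    then show ?thesis
      using X(1)[of k] by auto
  qed
  have X_lim: "X \<longlonglongrightarrow> (z, w)"
  proof (rule metric_LIMSEQ_I)
    fix r :: real assume "r > 0"
    obtain N where N: "d / r < real N"
      using reals_Archimedean2 by blast
    have "dist (X k) (z, w) < r" if "k \<ge> N" for k
    proof -
      have "d < r * real (Suc k)"
        using N that \<open>r > 0\<close> by (simp add: divide_less_eq mult.commute)
          (smt (verit, ccfv_SIG) mult_left_mono of_nat_mono)
      then have "d / real (Suc k) < r"
        by (simp add: divide_less_eq)
      then show ?thesis
        using X(1)[of k] by (simp add: dist_commute)
    qed
    then show "\<exists>N. \<forall>k\<ge>N. dist (X k) (z, w) < r" by blast
  qed
  obtain D where D: "\<And>x y. x \<in> cball (z, w) d \<Longrightarrow> y \<in> Y \<Longrightarrow> cmod (K (fst x) (snd x) (fst y) (snd y)) \<le> D"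
    using abs_kernel_bounded_on_compact[OF compact_cball d(2) Y] by blast
  have integrand: "op_integrand K j0 f x y = indicator Y y * (K (fst x) (snd x) (fst y) (snd y) * cnj (sgn (K z w (fst y) (snd y))))" for x y
    using Y by (auto simp: op_integrand_def f_def indicator_def)
  have dom_int: "integrable lborel (\<lambda>y. indicator Y y * D)"
    using borel_integrable_compact[OF Y(1), of "\<lambda>_. D"] by simp
  have ptw: "(\<lambda>k. op_integrand K j0 f (X k) y) \<longlonglongrightarrow> op_integrand K j0 f (z, w) y" for y
  proof (cases "y \<in> Y")
    case True
    then have "continuous_on (TB j0 \<times> TB j0) (\<lambda>x. K (fst x) (snd x) (fst y) (snd y))"
      using Y by (intro K_continuous) auto
    then have "isCont (\<lambda>x. K (fst x) (snd x) (fst y) (snd y)) (z, w)"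
      using TB2 continuous_on_eq_continuous_at by blast
    from isCont_tendsto_compose[OF this X_lim] show ?thesis
      unfolding integrand by (intro tendsto_intros)
  qed (simp add: integrand)
  have bound: "norm (op_integrand K j0 f x y) \<le> indicator Y y * D" if "x \<in> cball (z, w) d" for x y
    using D[OF that, of y] norm_sgn[of "K z w (fst y) (snd y)"]
    by (auto simp: integrand indicator_def norm_mult intro: order_trans[OF norm_ge_zero])
  have int: "integrable lborel (op_integrand K j0 f (z, w))"
    using bound[of "(z, w)"] d
    by (intro Bochner_Integration.integrable_bound[OF dom_int])
       (auto intro!: AE_I2 order_trans[OF _ abs_ge_self])
  have lim: "(\<lambda>k. \<integral>y. op_integrand K j0 f (X k) y \<partial>lborel) \<longlonglongrightarrow> (\<integral>y. op_integrand K j0 f (z, w) y \<partial>lborel)"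
    by (rule integral_dominated_convergence[OF _ _ dom_int])
       (auto intro!: AE_I2 ptw bound X_cball)
  have "rho j0 z > 0" "rho j0 w > 0"
    using z w by (auto simp: mem_TB_iff)
  moreover have "(\<lambda>k. rho j0 (fst (X k))) \<longlonglongrightarrow> rho j0 z" "(\<lambda>k. rho j0 (snd (X k))) \<longlonglongrightarrow> rho j0 w"
    using continuous_on_tendsto_compose[OF continuous_on_rho[OF continuous_on_fst[OF continuous_on_id[of UNIV]]] X_lim]
      continuous_on_tendsto_compose[OF continuous_on_rho[OF continuous_on_snd[OF continuous_on_id[of UNIV]]] X_lim] by auto
  ultimately have "(\<lambda>k. op_apply a1 a2 K j0 f (X k)) \<longlonglongrightarrow> op_apply a1 a2 K j0 f (z, w)"
    unfolding op_apply_def lborel_prod fst_conv snd_conv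
    by (intro tendsto_intros lim) auto
  then have "(\<lambda>k. norm (op_apply a1 a2 K j0 f (X k))) \<longlonglongrightarrow> norm (op_apply a1 a2 K j0 f (z, w))"
    by (rule tendsto_norm)
  moreover obtain v where v: "ennreal C * V = ennreal v" "v \<ge> 0"
    using V_fin C by (cases V) (auto simp flip: ennreal_mult)
  moreover have "norm (op_apply a1 a2 K j0 f (X k)) \<le> v" for k
    using X(2)[of k] v by simp
  ultimately have "norm (op_apply a1 a2 K j0 f (z, w)) \<le> v"
    by (intro LIMSEQ_le_const2) auto
  then have fin: "ennreal (norm (op_apply a1 a2 K j0 f (z, w))) \<le> ennreal C * V"
    using v by simp
  \<comment> \<open>At the point whose phase was used, a * cnj (sgn a) = |a|, also for a = 0 because
    \<open>sgn 0 = 0\<close>.\<close>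
  have phase: "op_integrand K j0 f (z, w) y = complex_of_real (indicator Y y * cmod (K z w (fst y) (snd y)))" for y
  proof -
    have "a * cnj (sgn a) = complex_of_real (cmod a)" for a
      by (simp add: sgn_div_norm scaleR_conv_of_real complex_norm_square[symmetric] power2_eq_square field_simps)
    then show ?thesis
      unfolding integrand by (simp add: indicator_def)
  qed
  have int': "integrable lborel (\<lambda>y. indicator Y y * cmod (K z w (fst y) (snd y)))"
    using int unfolding phase[abs_def] complex_of_real_integrable_eq .
  have "op_apply a1 a2 K j0 f (z, w) = of_real (rho j0 z powr a1 * rho j0 w powr a2 *
    (\<integral>y. indicator Y y * cmod (K z w (fst y) (snd y)) \<partial>lborel))"
    unfolding op_apply_def lborel_prod phase[abs_def] integral_complex_of_real by simp
  then have "ennreal (norm (op_apply a1 a2 K j0 f (z, w))) = ennreal (rho j0 z powr a1 * rho j0 w powr a2) *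
    ennreal (\<integral>y. indicator Y y * cmod (K z w (fst y) (snd y)) \<partial>lborel)"
    by (simp add: norm_mult abs_mult ennreal_mult)
  also have "ennreal (\<integral>y. indicator Y y * cmod (K z w (fst y) (snd y)) \<partial>lborel)
    = (\<integral>\<^sup>+y. ennreal (indicator Y y * cmod (K z w (fst y) (snd y))) \<partial>lborel)"
    using int' by (subst nn_integral_eq_integral) auto
  also have "\<dots> = (\<integral>\<^sup>+y. (indicator B (fst y) * ennreal (rho j0 (fst y) powr b1 / cmod (rho2 j0 z (fst y)) powr c1)) *
      (indicator E (snd y) * ennreal (rho j0 (snd y) powr b2 / cmod (rho2 j0 w (snd y)) powr c2)) \<partial>lborel)"
    using B E z w by (intro nn_integral_cong)
      (auto simp: Y_def indicator_def norm_K subset_iff simp flip: ennreal_mult)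
  also have "\<dots> = (\<integral>\<^sup>+\<eta>. \<integral>\<^sup>+u. (indicator B u * ennreal (rho j0 u powr b1 / cmod (rho2 j0 z u) powr c1)) *
      (indicator E \<eta> * ennreal (rho j0 \<eta> powr b2 / cmod (rho2 j0 w \<eta>) powr c2)) \<partial>lborel \<partial>lborel)"
    unfolding lborel_prod[symmetric] by (subst lborel_pair.nn_integral_snd[symmetric]) (auto simp: lborel_prod)
  also have "\<dots> = (\<integral>\<^sup>+u. indicator B u * ennreal (rho j0 u powr b1 / cmod (rho2 j0 z u) powr c1) \<partial>lborel) *
       (\<integral>\<^sup>+\<eta>. indicator E \<eta> * ennreal (rho j0 \<eta> powr b2 / cmod (rho2 j0 w \<eta>) powr c2) \<partial>lborel)"
    by (subst nn_integral_multc, measurable) (subst nn_integral_cmult, auto)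
  finally show ?thesis
    using fin by (simp add: V_def)
qed

text \<open>The test estimate is applied with \<open>B\<close> a small ball about \<open>u0\<close>,
  on which the first factor divided by the weight exceeds half its value at \<open>u0\<close>; this
  is the source of the 2 in \<open>2 * C\<close>. Monotone convergence along compact sets
  \<open>E\<close> gives the full integral of the second factor.\<close>

lemma kernel_pointwise_bound:
  assumes C: "C \<ge> 0"
    and bnd: "\<And>f. f \<in> borel_measurable borel \<Longrightarrow> mixnorm_1inf j0 \<alpha>1 \<alpha>2 f < \<infinity> \<Longrightarrow>
      Linf_norm j0 (op_apply a1 a2 K j0 f) \<le> ennreal C * mixnorm_1inf j0 \<alpha>1 \<alpha>2 f"
    and z: "z \<in> TB j0" and w: "w \<in> TB j0" and u0: "u0 \<in> TB j0"
  shows "ennreal (rho j0 z powr a1 * rho j0 w powr a2 * (rho j0 u0 powr (b1 - \<alpha>1) / cmod (rho2 j0 z u0) powr c1)) *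
      kernel_integral j0 b2 c2 w \<le> ennreal (2 * C)"
proof -
  define h where "h u = rho j0 u powr (b1 - \<alpha>1) / cmod (rho2 j0 z u) powr c1" for u
  have nz: "rho2 j0 z u \<noteq> 0" if "u \<in> TB j0" for u
    using norm_rho2_ge[of j0 z u] that z by (auto simp: mem_TB_iff)
  have h_cont: "continuous_on (TB j0) h"
    unfolding h_def by (intro continuous_intros) (auto simp: mem_TB_iff nz)
  have h0: "h u0 > 0"
    using u0 nz[OF u0] by (auto simp: h_def mem_TB_iff)
  have "open (TB j0 \<inter> h -` {h u0 / 2<..})"
    using h_cont by (intro continuous_open_preimage open_TB) auto
  moreover have "u0 \<in> TB j0 \<inter> h -` {h u0 / 2<..}"
    using u0 h0 by simp
  ultimately obtain e where e: "e > 0" "cball u0 e \<subseteq> TB j0 \<inter> h -` {h u0 / 2<..}"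
    using open_contains_cball by blast
  have [measurable]: "cball u0 e \<in> sets borel"
    by (simp add: borel_closed)
  define V where "V = (\<integral>\<^sup>+u. indicator (cball u0 e) u * ennreal (rho j0 u powr \<alpha>1) \<partial>lborel)"
  have "integrable lborel (\<lambda>u. indicator (cball u0 e) u *\<^sub>R (rho j0 u powr \<alpha>1))"
    using e by (intro borel_integrable_compact continuous_intros) (fastforce simp: mem_TB_iff)+
  then have "(\<integral>\<^sup>+u. ennreal (norm (indicator (cball u0 e) u *\<^sub>R (rho j0 u powr \<alpha>1))) \<partial>lborel) < \<infinity>"
    by (simp add: integrable_iff_bounded)
  also have "(\<integral>\<^sup>+u. ennreal (norm (indicator (cball u0 e) u *\<^sub>R (rho j0 u powr \<alpha>1))) \<partial>lborel) = V"
    unfolding V_def by (intro nn_integral_cong) (auto simp: indicator_def)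
  finally have V_fin: "V < \<infinity>" .
  \<comment> \<open>The weighted volume of the ball stands on both sides of the estimate; being
    positive and finite, it can be cancelled.\<close>
  have "V \<noteq> 0"
  proof
    assume "V = 0"
    then have "AE u in lborel. indicator (cball u0 e) u * ennreal (rho j0 u powr \<alpha>1) = 0"
      unfolding V_def by (subst (asm) nn_integral_0_iff_AE) auto
    from AE_lborel_open_ex[OF this open_ball[of u0 e]] e
    obtain u where "u \<in> ball u0 e" "indicator (cball u0 e) u * ennreal (rho j0 u powr \<alpha>1) = 0"
      by auto
    then have "u \<in> TB j0" "rho j0 u powr \<alpha>1 \<le> 0"
      using e by (auto simp: indicator_def ennreal_eq_0_iff split: if_splits)
    then show False
      by (auto simp: mem_TB_iff powr_eq_0_iff)
  qed
  then obtain v where v: "V = ennreal v" "v > 0"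
    using V_fin by (cases V) auto
  have V_le: "ennreal (h u0 / 2) * V \<le>
     (\<integral>\<^sup>+u. indicator (cball u0 e) u * ennreal (rho j0 u powr b1 / cmod (rho2 j0 z u) powr c1) \<partial>lborel)"
    unfolding V_def
  proof (subst nn_integral_cmult[symmetric], measurable, intro nn_integral_mono)
    fix u
    show "ennreal (h u0 / 2) * (indicator (cball u0 e) u * ennreal (rho j0 u powr \<alpha>1)) \<le>
       indicator (cball u0 e) u * ennreal (rho j0 u powr b1 / cmod (rho2 j0 z u) powr c1)"
    proof (cases "u \<in> cball u0 e")
      case True
      then have "h u0 / 2 * rho j0 u powr \<alpha>1 \<le> h u * rho j0 u powr \<alpha>1"
        using e by (intro mult_right_mono) auto
      also have "\<dots> = rho j0 u powr b1 / cmod (rho2 j0 z u) powr c1"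
        unfolding h_def times_divide_eq_left powr_add[symmetric] by simp
      finally show ?thesis
        using True h0 by (auto simp flip: ennreal_mult intro!: ennreal_leI)
    qed simp
  qed
  \<comment> \<open>A compact exhaustion of the domain: bounded sets that keep a positive distance
    in height from the boundary.\<close>
  define E where "E m = {\<eta> \<in> cball 0 (real m). 1 / real (Suc m) \<le> rho j0 \<eta>}" for m
  define F where "F m \<eta> = indicator (E m) \<eta> * ennreal (rho j0 \<eta> powr b2 / cmod (rho2 j0 w \<eta>) powr c2)" for m \<eta>
  have "E m = cball 0 (real m) \<inter> {\<eta>. 1 / real (Suc m) \<le> rho j0 \<eta>}" for m
    by (auto simp: E_def)
  then have E_compact: "compact (E m)" for m
    by (auto intro!: compact_Int_closed closed_Collect_le continuous_intros)
  have E_TB: "E m \<subseteq> TB j0" for m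
  proof
    fix \<eta> assume "\<eta> \<in> E m"
    then have "1 / real (Suc m) \<le> rho j0 \<eta>"
      by (simp add: E_def)
    moreover have "0 < 1 / real (Suc m)"
      by simp
    ultimately show "\<eta> \<in> TB j0"
      unfolding mem_TB_iff by (rule less_le_trans[rotated])
  qed
  have [measurable]: "E m \<in> sets borel" for m
    using E_compact by (auto intro: borel_compact)
  have E_mono: "E m \<subseteq> E (Suc m)" for m
  proof
    fix \<eta> assume "\<eta> \<in> E m"
    moreover have "1 / real (Suc (Suc m)) \<le> 1 / real (Suc m)"
      by (simp add: frac_le)
    ultimately show "\<eta> \<in> E (Suc m)"
      unfolding E_def by (auto intro: order_trans)
  qed
  have E_ex: "\<exists>m. \<eta> \<in> E m" if "\<eta> \<in> TB j0" for \<eta>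
  proof -
    have pos: "rho j0 \<eta> > 0"
      using that by (simp add: mem_TB_iff)
    obtain m where m: "max (norm \<eta>) (1 / rho j0 \<eta>) < real m"
      using reals_Archimedean2 by blast
    then have "1 / rho j0 \<eta> \<le> real (Suc m)"
      by simp
    then have "1 / real (Suc m) \<le> rho j0 \<eta>"
      using pos by (simp add: field_simps)
    then show ?thesis
      using m by (auto simp: E_def intro!: exI[of _ m])
  qed
  have incF: "incseq F"
    using E_mono by (intro incseq_SucI) (auto simp: F_def le_fun_def indicator_def)
  have "kernel_integral j0 b2 c2 w = (\<integral>\<^sup>+\<eta>. (SUP m. F m \<eta>) \<partial>lborel)"
    unfolding kernel_integral_def
  proof (rule nn_integral_cong)
    fix \<eta>
    show "indicator (TB j0) \<eta> * ennreal (rho j0 \<eta> powr b2 / cmod (rho2 j0 w \<eta>) powr c2) = (SUP m. F m \<eta>)"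
    proof (cases "\<eta> \<in> TB j0")
      case True
      then obtain m where "\<eta> \<in> E m"
        using E_ex by blast
      then have "ennreal (rho j0 \<eta> powr b2 / cmod (rho2 j0 w \<eta>) powr c2) = F m \<eta>"
        by (simp add: F_def)
      also have "\<dots> \<le> (SUP m. F m \<eta>)"
        by (rule SUP_upper) simp
      finally show ?thesis
        using True by (intro antisym SUP_least) (auto simp: F_def indicator_def)
    next
      case False
      then have "F m \<eta> = 0" for m
        using E_TB[of m] by (auto simp: F_def indicator_def)
      then show ?thesis
        using False by simp
    qed
  qed
  also have "\<dots> = (SUP m. integral\<^sup>N lborel (F m))"
    by (rule nn_integral_monotone_convergence_SUP[OF incF]) (unfold F_def, measurable)
  finally have ki: "kernel_integral j0 b2 c2 w = (SUP m. integral\<^sup>N lborel (F m))" .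
  define R where "R = rho j0 z powr a1 * rho j0 w powr a2"
  have R: "R \<ge> 0" by (simp add: R_def)
  have "ennreal (R * h u0) * integral\<^sup>N lborel (F m) \<le> ennreal (2 * C)" for m
  proof -
    have "ennreal R * ((ennreal (h u0 / 2) * V) * integral\<^sup>N lborel (F m)) \<le> ennreal R *
       ((\<integral>\<^sup>+u. indicator (cball u0 e) u * ennreal (rho j0 u powr b1 / cmod (rho2 j0 z u) powr c1) \<partial>lborel)
        * integral\<^sup>N lborel (F m))"
      using V_le by (intro mult_left_mono mult_right_mono) auto
    also have "\<dots> \<le> ennreal C * V"
      unfolding F_def V_def R_def using e
      by (intro compact_test_estimate[OF C bnd z w compact_cball _ E_compact E_TB]) auto
    finally have *: "ennreal R * ((ennreal (h u0 / 2) * V) * integral\<^sup>N lborel (F m)) \<le> ennreal C * V" .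
    have "ennreal v * (ennreal (R * (h u0 / 2)) * integral\<^sup>N lborel (F m)) \<le> ennreal v * ennreal C"
    proof -
      have "ennreal (R * (h u0 / 2)) = ennreal R * ennreal (h u0 / 2)"
        using R h0 by (intro ennreal_mult) auto
      then show ?thesis
        using * unfolding v(1) by (simp only: mult_ac)
    qed
    then have half: "ennreal (R * (h u0 / 2)) * integral\<^sup>N lborel (F m) \<le> ennreal C"
      using v(2) by (simp add: ennreal_mult_le_mult_iff)
    have "ennreal (R * h u0) = ennreal 2 * ennreal (R * (h u0 / 2))"
      using R h0 by (subst ennreal_mult[symmetric]) auto
    then have "ennreal (R * h u0) * integral\<^sup>N lborel (F m) = ennreal 2 * (ennreal (R * (h u0 / 2)) * integral\<^sup>N lborel (F m))"
      by (simp only: mult.assoc)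
    also have "\<dots> \<le> ennreal 2 * ennreal C"
      using half by (rule mult_left_mono) simp
    also have "\<dots> = ennreal (2 * C)"
      using C by (subst ennreal_mult) auto
    finally show ?thesis .
  qed
  then show ?thesis
    unfolding ki R_def[symmetric] h_def[symmetric] by (subst SUP_mult_left_ennreal) (auto intro!: SUP_least)
qed

text \<open>On the ray of points whose only nonzero coordinate is i t at \<open>j0\<close>, heights
  and kernel become explicit, and the pointwise bound turns into one inequality in three free
  positive parameters t, s, r.\<close>

lemma bounded_imp_exponents:
  assumes "bounded_1inf_to_inf a1 a2 K j0 \<alpha>1 \<alpha>2"
  shows "a1 \<ge> 0 \<and> a2 > 0 \<and> b1 \<ge> \<alpha>1 \<and> b2 > -1 \<and> c1 = a1 + b1 - \<alpha>1 \<and> c2 = real CARD('n) + 1 + a2 + b2"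
proof -
  obtain C where C: "C \<ge> 0" and bnd: "\<And>f. f \<in> borel_measurable borel \<Longrightarrow> mixnorm_1inf j0 \<alpha>1 \<alpha>2 f < \<infinity> \<Longrightarrow>
      Linf_norm j0 (op_apply a1 a2 K j0 f) \<le> ennreal C * mixnorm_1inf j0 \<alpha>1 \<alpha>2 f"
    using assms unfolding bounded_1inf_to_inf_def lborel_prod by auto
  define p :: "real \<Rightarrow> complex^'n" where "p t = axis j0 (\<i> * of_real t)" for t
  have rho_p: "rho j0 (p t) = t" for t
    by (simp add: rho_def p_def axis_def)
  have rho2_p: "cmod (rho2 j0 (p t) (p s)) = (t + s) / 2" if "t > 0" "s > 0" for t s
  proof -
    have "rho2 j0 (p t) (p s) = of_real ((t + s) / 2)"
      by (simp add: rho2_def p_def axis_def complex_eq_iff field_simps)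
    then show ?thesis
      using that by (simp only: norm_of_real) simp
  qed
  have p_TB: "p t \<in> TB j0" if "t > 0" for t
    using that by (simp add: mem_TB_iff rho_p)
  \<comment> \<open>The total exponent of the height of w: a2 from the outer weight, the rest from
    the homogeneity of the kernel integral.\<close>
  define q where "q = a2 + (real CARD('n) + 1 + b2 - c2)"
  have est: "ennreal (t powr a1 * s powr (b1 - \<alpha>1) / ((t + s) / 2) powr c1 * r powr q) * flat_integral j0 b2 c2 1 \<le> ennreal (2 * C)"
    if "t > 0" "s > 0" "r > 0" for t s r
  proof -
    have "ennreal (t powr a1 * r powr a2 * (s powr (b1 - \<alpha>1) / ((t + s) / 2) powr c1)) *
        (ennreal (r powr (real CARD('n) + 1 + b2 - c2)) * flat_integral j0 b2 c2 1) \<le> ennreal (2 * C)"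
      using kernel_pointwise_bound[OF C bnd p_TB p_TB p_TB, of t r s] that
      by (simp add: kernel_integral_eq[OF p_TB] rho_p rho2_p)
    also have "ennreal (t powr a1 * r powr a2 * (s powr (b1 - \<alpha>1) / ((t + s) / 2) powr c1)) *
        (ennreal (r powr (real CARD('n) + 1 + b2 - c2)) * flat_integral j0 b2 c2 1)
      = ennreal (t powr a1 * r powr a2 * (s powr (b1 - \<alpha>1) / ((t + s) / 2) powr c1) * r powr (real CARD('n) + 1 + b2 - c2))
         * flat_integral j0 b2 c2 1"
      by (subst ennreal_mult) (auto simp: mult.assoc)
    also have "t powr a1 * r powr a2 * (s powr (b1 - \<alpha>1) / ((t + s) / 2) powr c1) * r powr (real CARD('n) + 1 + b2 - c2)
      = t powr a1 * s powr (b1 - \<alpha>1) / ((t + s) / 2) powr c1 * r powr q"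
      unfolding q_def powr_add by simp
    finally show ?thesis .
  qed
  \<comment> \<open>At t = s = r = 1 the coefficient is 1, so the bound itself gives
    finiteness.\<close>
  have fin: "flat_integral j0 b2 c2 1 < \<infinity>"
    using le_less_trans[OF est[of 1 1 1]] by simp
  then obtain I where I: "flat_integral j0 b2 c2 1 = ennreal I" "I > 0"
    using flat_integral_pos[of 1 j0 b2 c2] by (cases "flat_integral j0 b2 c2 1") auto
  define D where "D = 2 * C / I"
  have D: "D \<ge> 0"
    using C I by (simp add: D_def)
  have real_est: "t powr a1 * s powr (b1 - \<alpha>1) / ((t + s) / 2) powr c1 * r powr q \<le> D"
    if "t > 0" "s > 0" "r > 0" for t s r
  proof -
    define x where "x = t powr a1 * s powr (b1 - \<alpha>1) / ((t + s) / 2) powr c1 * r powr q"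
    have "ennreal (x * I) \<le> ennreal (2 * C)"
      using est[OF that] I unfolding x_def[symmetric] I(1) by (subst ennreal_mult'') auto
    then have "x * I \<le> 2 * C"
      using C by simp
    then show ?thesis
      using I(2) unfolding x_def[symmetric] D_def by (simp add: pos_le_divide_eq)
  qed
  have "q = 0"
  proof (rule zero_exponent_if_powr_bounded)
    fix r :: real assume "r > 0"
    then show "r powr q \<le> D"
      using real_est[of 1 1 r] by simp
  qed
  \<comment> \<open>Along t = s the first factor is a pure power of t, bounded on the whole
    half-line, so its exponent vanishes.\<close>
  have "a1 + (b1 - \<alpha>1) + - c1 = 0"
  proof (rule zero_exponent_if_powr_bounded)
    fix t :: real assume "t > 0"
    then show "t powr (a1 + (b1 - \<alpha>1) + - c1) \<le> D"
      using real_est[of t t 1] unfolding powr_add powr_minus_divide by simp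
  qed
  then have c1: "c1 = a1 + b1 - \<alpha>1" by simp
  \<comment> \<open>With one height fixed at 1 and the other in (0, 1], the mean (t + 1)/2 stays in
    [1/2, 1], and \<open>M\<close> bounds its power for either sign of c1. Letting that other height
    tend to 0 then isolates the exponents a1 and b1 - \<alpha>1.\<close>
  define M where "M = max 1 ((1/2) powr c1)"
  have M: "((t + 1) / 2) powr c1 \<le> M" if "0 < t" "t \<le> 1" for t
  proof (cases "c1 \<ge> 0")
    case True
    then have "((t + 1) / 2) powr c1 \<le> 1 powr c1"
      using that by (intro powr_mono2) auto
    then show ?thesis by (simp add: M_def)
  next
    case False
    then have "((t + 1) / 2) powr c1 \<le> (1/2) powr c1"
      using that by (intro powr_mono2') auto
    then show ?thesis by (simp add: M_def)
  qed
  have le_DM: "x \<le> D * M" if "0 < t" "t \<le> 1" "x / ((t + 1) / 2) powr c1 \<le> D" for x t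
  proof -
    have "x \<le> D * ((t + 1) / 2) powr c1"
      using that(3) \<open>0 < t\<close> by (simp add: pos_divide_le_eq)
    also have "\<dots> \<le> D * M"
      using M[OF that(1,2)] D by (rule mult_left_mono)
    finally show ?thesis .
  qed
  have "a1 \<ge> 0"
    using real_est[of _ 1 1] by (intro nonneg_exponent_if_powr_bounded_near_0[of _ "D * M"] le_DM) auto
  moreover have "b1 - \<alpha>1 \<ge> 0"
    using real_est[of 1 _ 1] by (intro nonneg_exponent_if_powr_bounded_near_0[of _ "D * M"] le_DM) (auto simp: add.commute)
  \<comment> \<open>Since q = 0 means c2 = n + 1 + a2 + b2, the strict inequality for c2 amounts to
    a2 > 0.\<close>
  moreover have "b2 > -1" "c2 > real CARD('n) + 1 + b2"
    using flat_integral_finite_imp_exponent_gt[OF fin] flat_integral_finite_imp_decay[OF fin] by auto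
  ultimately show ?thesis
    using \<open>q = 0\<close> c1 by (auto simp: q_def)
qed

lemma bounded_iff:
  "bounded_1inf_to_inf a1 a2 K j0 \<alpha>1 \<alpha>2 \<longleftrightarrow>
    a1 \<ge> 0 \<and> a2 > 0 \<and> b1 \<ge> \<alpha>1 \<and> b2 > -1 \<and> c1 = a1 + b1 - \<alpha>1 \<and> c2 = real CARD('n) + 1 + a2 + b2"
  using bounded_imp_exponents bounded_if_exponents by blast

end

section \<open>The kernels of S and T as instances\<close>

lemma rho2_Re_pos: "z \<in> TB j0 \<Longrightarrow> u \<in> TB j0 \<Longrightarrow> Re (rho2 j0 z u) > 0"
  using Re_rho2_ge[of j0 z u] by (auto simp: mem_TB_iff)

interpretation S: TB_kernel j0 b1 b2 c1 c2 "S_kernel j0 b1 b2 c1 c2" for j0 b1 b2 c1 c2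
proof
  show "(\<lambda>(x, y). S_kernel j0 b1 b2 c1 c2 (fst x) (snd x) (fst y) (snd y)) \<in> borel_measurable (borel \<Otimes>\<^sub>M borel)"
    unfolding S_kernel_def by measurable
next
  fix z w u \<eta> assume "z \<in> TB j0" "w \<in> TB j0" "u \<in> TB j0" "\<eta> \<in> TB j0"
  show "cmod (S_kernel j0 b1 b2 c1 c2 z w u \<eta>) = (rho j0 u powr b1 / cmod (rho2 j0 z u) powr c1) *
        (rho j0 \<eta> powr b2 / cmod (rho2 j0 w \<eta>) powr c2)"
    unfolding S_kernel_def by (simp only: norm_of_real) (simp add: abs_mult)
next
  fix u \<eta> assume "u \<in> TB j0" "\<eta> \<in> TB j0"
  then have "rho2 j0 x u \<noteq> 0" "rho2 j0 x \<eta> \<noteq> 0" if "x \<in> TB j0" for x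
    using that rho2_Re_pos[of x j0] by fastforce+
  then show "continuous_on (TB j0 \<times> TB j0) (\<lambda>x. S_kernel j0 b1 b2 c1 c2 (fst x) (snd x) u \<eta>)"
    unfolding S_kernel_def by (intro continuous_intros) auto
qed

text \<open>For a real exponent the argument of s contributes only a phase.\<close>

lemma norm_powr_of_real:
  "s \<noteq> 0 \<Longrightarrow> cmod (s powr complex_of_real c) = cmod s powr c"
  by (simp add: powr_def)

interpretation T: TB_kernel j0 b1 b2 c1 c2 "T_kernel j0 b1 b2 c1 c2" for j0 b1 b2 c1 c2
proof
  show "(\<lambda>(x, y). T_kernel j0 b1 b2 c1 c2 (fst x) (snd x) (fst y) (snd y)) \<in> borel_measurable (borel \<Otimes>\<^sub>M borel)"
    unfolding T_kernel_def by measurable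
next
  fix z w u \<eta> assume "z \<in> TB j0" "w \<in> TB j0" "u \<in> TB j0" "\<eta> \<in> TB j0"
  then have "rho2 j0 z u \<noteq> 0" "rho2 j0 w \<eta> \<noteq> 0"
    using rho2_Re_pos[of z j0 u] rho2_Re_pos[of w j0 \<eta>] by auto
  then show "cmod (T_kernel j0 b1 b2 c1 c2 z w u \<eta>) = (rho j0 u powr b1 / cmod (rho2 j0 z u) powr c1) *
        (rho j0 \<eta> powr b2 / cmod (rho2 j0 w \<eta>) powr c2)"
    unfolding T_kernel_def norm_divide norm_mult norm_of_real by (simp add: norm_powr_of_real abs_mult)
next
  fix u \<eta> assume u: "u \<in> TB j0" "\<eta> \<in> TB j0"
  \<comment> \<open>These conditions keep \<open>rho2\<close> in the closed right half-plane without
    0, away from the branch cut, where principal powers are continuous.\<close>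
  have nonneg: "Re (rho2 j0 x u) \<ge> 0" "Re (rho2 j0 x \<eta>) \<ge> 0"
    and nz: "rho2 j0 x u \<noteq> 0" "rho2 j0 x \<eta> \<noteq> 0" if "x \<in> TB j0" for x
    using rho2_Re_pos[OF that u(1)] rho2_Re_pos[OF that u(2)] by auto
  show "continuous_on (TB j0 \<times> TB j0) (\<lambda>x. T_kernel j0 b1 b2 c1 c2 (fst x) (snd x) u \<eta>)"
    unfolding T_kernel_def
    by (intro continuous_intros) (auto simp: nonneg nz)
qed

theorem theorem6p10:
  fixes j0 :: "'n::finite"
    and a1 a2 b1 b2 c1 c2 \<alpha>1 \<alpha>2 :: real
  assumes "\<alpha>1 > -1" and "\<alpha>2 > -1"
  shows "(bounded_1inf_to_inf a1 a2 (S_kernel j0 b1 b2 c1 c2) j0 \<alpha>1 \<alpha>2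
            \<longleftrightarrow> bounded_1inf_to_inf a1 a2 (T_kernel j0 b1 b2 c1 c2) j0 \<alpha>1 \<alpha>2)
       \<and> (bounded_1inf_to_inf a1 a2 (T_kernel j0 b1 b2 c1 c2) j0 \<alpha>1 \<alpha>2
            \<longleftrightarrow> (a1 \<ge> 0 \<and> a2 > 0 \<and> b1 \<ge> \<alpha>1 \<and> b2 > -1 \<and> c1 = a1 + b1 - \<alpha>1
                 \<and> c2 = real CARD('n) + 1 + a2 + b2))"
  using S.bounded_iff[where ?j0.0=j0] T.bounded_iff[where ?j0.0=j0] by simp

end
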